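(* Let $(\bar y,\bar w,\overline S)\in\mathbb{R}^e\times\mathbb{R}^d\times\mathbb{R}^{m\times n}$ be an optimal solution of problem (D) $$\max_{y,w,S}\ -\langle b,y\rangle-\delta_{\mathcal Q^\circ}(y)-h^*(w)\quad\text{s.t.}\quad \mathcal A^*y+\mathcal F^*w+S+C=0,\ \|S\|_2\le 1$$ with $\mathcal M_D(\bar y,\bar w,\overline S)\neq\emptyset$. Let $\overline X\in\mathcal M_D(\bar y,\bar w,\overline S)$. Then the following two statements are equivalent to each other: (i) The second order sufficient condition holds at $(\bar y,\bar w,\overline S)$ for $\overline X$ with respect to the dual problem (D), i.e., $$\langle H_w,(\nabla h^* )'(\bar w;H_w)\rangle-\phi^*_{(\overline S,H_S)}(\overline X)>0\quad\text{for all }(H_y,H_w,H_S)\in\mathcal C(\bar y,\bar w,\overline S)\setminus\{0\},$$ where $$\mathcal C(\bar y,\bar w,\overline S):=\left\{(H_y,H_w,H_S)\in\mathbb{R}^e\times\mathbb{R}^d\times\mathbb{R}^{m\times n}\ \middle|\ \begin{array}{c}\mathcal A^*H_y+\mathcal F^*H_w+H_S=0,\\ H_y\in\mathcal C_{\mathcal Q^\circ}(\bar y,\mathcal A\overline X-b),\ H_S\in\mathcal C_{\theta^*}(\overline S,\overline X)\end{array}\right\}.$$ (ii) The strict Robinson constraint qualification holds at $\overline X$ for $(\bar y,\bar w,\overline S)$ with respect to the primal problem (P), i.e., $$\begin{pmatrix}\mathcal A\\ \mathcal I_{\mathbb{R}^{m\times n}}\end{pmatrix}\mathbb{R}^{m\times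 n}+\begin{pmatrix}\mathcal C_{\mathcal Q}(\mathcal A\overline X-b,\bar y)\\ \mathcal C_\theta(\overline X,\overline S)\end{pmatrix}=\begin{pmatrix}\mathbb{R}^e\\ \mathbb{R}^{m\times n}\end{pmatrix}.$$
   Context: Data: $h:\mathbb{R}^d\to(-\infty,+\infty]$ is a proper closed convex function whose effective domain $\mathrm{dom}\,h$ is a nonempty open convex set; $h$ is twice continuously differentiable on $\mathrm{dom}\,h$ and essentially strictly convex (strictly convex on every convex subset of $\mathrm{dom}\,\partial h$). $h^*$ is the conjugate of $h$; on $\mathrm{int}(\mathrm{dom}\,h^* )$ the function $h^*$ is differentiable and $\nabla h^*$ is locally Lipschitz continuous and directionally differentiable, with directional derivative $(\nabla h^* )'(w;\cdot)$, while $\partial h^*(w)=\emptyset$ for $w\notin\mathrm{int}(\mathrm{dom}\,h^* )$. $\mathcal F:\mathbb{R}^{m\times n}\to\mathbb{R}^d$ and $\mathcal A:\mathbb{R}^{m\times n}\to\mathbb{R}^e$ are linear with adjoints $\mathcal F^*,\mathcal A^*$; $C\in\mathbb{R}^{m\times n}$, $b\in\mathbb{R}^e$; $\mathcal Q\subseteq\mathbb{R}^e$ is a nonempty convex polyhedral cone with polar cone $\mathcal Q^\circ$. $\|\cdot\|_*$ is the nuclear norm (sum of singular values), $\|\cdot\|_2$ the spectral norm, $\delta_D$ the indicator function of $D$, $\mathcal I$ the identity. $\mathcal N_K$, $\mathcal T_K$ denote normal and tangent cones of a convex set $K$. The primal problem (P), of which (D) is the Lagrangian dual, is: minimize $h(\mathcal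 F X)+\langle C,X\rangle+\|X\|_*$ over $X\in\mathbb{R}^{m\times n}$ subject to $\mathcal A X-b\in\mathcal Q$. The optimal solution sets of (P) and (D) are assumed nonempty. Let $\theta=\|\cdot\|_*$ on $\mathbb{R}^{m\times n}$, so that $\theta^*$ is the indicator function of $\{S\mid\|S\|_2\le1\}$. $\mathcal M_D(\bar y,\bar w,\overline S)$ is the set of Lagrange multipliers of (D) at $(\bar y,\bar w,\overline S)$: all $X\in\mathbb{R}^{m\times n}$ with $\mathcal A X-b\in\mathcal N_{\mathcal Q^\circ}(\bar y)$, $\mathcal F X\in\partial h^*(\bar w)$, $X\in\partial\theta^*(\overline S)$ and $\mathcal A^*\bar y+\mathcal F^*\bar w+\overline S+C=0$. For $y\in\mathcal N_{\mathcal Q}(q)$: $\mathcal C_{\mathcal Q}(q,y)=\mathcal T_{\mathcal Q}(q)\cap y^\perp$ and $\mathcal C_{\mathcal Q^\circ}(y,q)=\mathcal T_{\mathcal Q^\circ}(y)\cap q^\perp$. Epiderivatives. For a proper closed convex function $f$ on a Euclidean space and $x\in\mathrm{dom} f$, the directional epiderivative is $f^{\downarrow}(x;d)=\liminf_{t\downarrow0,\,d'\to d}\frac{f(x+td')-f(x)}{t}$, and, when $f^\downarrow(x;d)$ is finite, the (lower) second order epiderivative is $f^{\downarrow\downarrow}_-(x;d,w)=\liminf_{t\downarrow0,\,w'\to w}\frac{f(x+td+\frac12t^2w')-f(x)-tf^\downarrow(x;d)}{\frac12t^2}$. For $B\in\partial\theta(A)$: $\mathcal C_\theta(A,B)=\{H\mid\theta^\downarrow(A;H)=\langle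 H,B\rangle\}$ (here $\theta^\downarrow(A;\cdot)$ is the usual directional derivative $\theta'(A;\cdot)$) and $\mathcal C_{\theta^*}(B,A)=\{H\mid(\theta^* )^\downarrow(B;H)=\langle H,A\rangle\}$. $\phi^*_{(B,H)}$ denotes the conjugate of the function $\phi_{(B,H)}=(\theta^* )^{\downarrow\downarrow}_-(B;H,\cdot)$. *)

theory Defs
  imports "HOL-Analysis.Analysis"
begin

definition eff_dom :: "('a \<Rightarrow> ereal) \<Rightarrow> 'a set" where
  "eff_dom f = {x. f x < \<infinity>}"

definition proper_fun :: "('a \<Rightarrow> ereal) \<Rightarrow> bool" where
  "proper_fun f \<longleftrightarrow> (\<forall>x. f x \<noteq> -\<infinity>) \<and> eff_dom f \<noteq> {}"

text \<open>The library constant \<^const>\<open>epigraph\<close> is restricted to real-valued functions.\<close>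

definition ereal_epigraph :: "('a \<Rightarrow> ereal) \<Rightarrow> ('a \<times> real) set" where
  "ereal_epigraph f = {(x, r). f x \<le> ereal r}"

definition proper_closed_convex :: "('a::euclidean_space \<Rightarrow> ereal) \<Rightarrow> bool" where
  "proper_closed_convex f \<longleftrightarrow>
     proper_fun f \<and> closed (ereal_epigraph f) \<and> convex (ereal_epigraph f)"

definition fenchel_conj :: "('a::euclidean_space \<Rightarrow> ereal) \<Rightarrow> 'a \<Rightarrow> ereal" where
  "fenchel_conj f y = (SUP x. ereal (x \<bullet> y) - f x)"

definition subdiff :: "('a::euclidean_space \<Rightarrow> ereal) \<Rightarrow> 'a \<Rightarrow> 'a set" where
  "subdiff f x = {g. \<bar>f x\<bar> \<noteq> \<infinity> \<and> (\<forall>z. f x + ereal (g \<bullet> (z - x)) \<le> f z)}"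

definition indicator_fun :: "'a set \<Rightarrow> 'a \<Rightarrow> ereal" where
  "indicator_fun D x = (if x \<in> D then 0 else \<infinity>)"

definition strictly_convex_on :: "'a::euclidean_space set \<Rightarrow> ('a \<Rightarrow> ereal) \<Rightarrow> bool" where
  "strictly_convex_on D f \<longleftrightarrow>
     (\<forall>x\<in>D. \<forall>z\<in>D. \<forall>u. x \<noteq> z \<longrightarrow> 0 < u \<longrightarrow> u < 1 \<longrightarrow>
        f ((1 - u) *\<^sub>R x + u *\<^sub>R z) < ereal (1 - u) * f x + ereal u * f z)"

definition essentially_strictly_convex :: "('a::euclidean_space \<Rightarrow> ereal) \<Rightarrow> bool" where
  "essentially_strictly_convex f \<longleftrightarrow>
     (\<forall>D. convex D \<and> D \<subseteq> {x. subdiff f x \<noteq> {}} \<longrightarrow> strictly_convex_on D f)"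

text \<open>The smoothness notions below are used only on open sets on which \<open>f\<close> is finite, so that
  \<open>real_of_ereal\<close> loses no information.\<close>

definition twice_cont_diff_on :: "('a::euclidean_space \<Rightarrow> ereal) \<Rightarrow> 'a set \<Rightarrow> bool" where
  "twice_cont_diff_on f U \<longleftrightarrow>
     (\<exists>(g :: 'a \<Rightarrow> 'a) (H :: 'a \<Rightarrow> 'a \<Rightarrow>\<^sub>L 'a).
        (\<forall>x\<in>U. GDERIV (\<lambda>z. real_of_ereal (f z)) x :> g x) \<and>
        (\<forall>x\<in>U. (g has_derivative blinfun_apply (H x)) (at x)) \<and>
        continuous_on U H)"

definition ereal_differentiable_on :: "('a::euclidean_space \<Rightarrow> ereal) \<Rightarrow> 'a set \<Rightarrow> bool" where
  "ereal_differentiable_on f U \<longleftrightarrow> (\<forall>x\<in>U. (\<lambda>z. real_of_ereal (f z)) differentiable (at x))"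

definition grad :: "('a::euclidean_space \<Rightarrow> ereal) \<Rightarrow> 'a \<Rightarrow> 'a" where
  "grad f x = (THE g. GDERIV (\<lambda>z. real_of_ereal (f z)) x :> g)"

definition locally_lipschitz_on ::
  "('a::euclidean_space \<Rightarrow> 'b::euclidean_space) \<Rightarrow> 'a set \<Rightarrow> bool" where
  "locally_lipschitz_on g U \<longleftrightarrow> (\<forall>x\<in>U. \<exists>e>0. \<exists>L. L-lipschitz_on (ball x e \<inter> U) g)"

definition dir_differentiable_on ::
  "('a::euclidean_space \<Rightarrow> 'b::euclidean_space) \<Rightarrow> 'a set \<Rightarrow> bool" where
  "dir_differentiable_on g U \<longleftrightarrow>
     (\<forall>x\<in>U. \<forall>d. \<exists>l. ((\<lambda>t. (g (x + t *\<^sub>R d) - g x) /\<^sub>R t) \<longlongrightarrow> l) (at_right 0))"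

definition dir_deriv ::
  "('a::euclidean_space \<Rightarrow> 'b::euclidean_space) \<Rightarrow> 'a \<Rightarrow> 'a \<Rightarrow> 'b" where
  "dir_deriv g x d = Lim (at_right 0) (\<lambda>t. (g (x + t *\<^sub>R d) - g x) /\<^sub>R t)"

definition polar_cone :: "'a::euclidean_space set \<Rightarrow> 'a set" where
  "polar_cone K = {y. \<forall>q\<in>K. q \<bullet> y \<le> 0}"

definition normal_cone :: "'a::euclidean_space set \<Rightarrow> 'a \<Rightarrow> 'a set" where
  "normal_cone K x = {v. x \<in> K \<and> (\<forall>z\<in>K. v \<bullet> (z - x) \<le> 0)}"

definition tangent_cone :: "'a::euclidean_space set \<Rightarrow> 'a \<Rightarrow> 'a set" where
  "tangent_cone K x =
     {d. x \<in> K \<and> (\<exists>(t :: nat \<Rightarrow> real) (d' :: nat \<Rightarrow> 'a).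
           (\<forall>k. t k > 0 \<and> x + t k *\<^sub>R d' k \<in> K) \<and>
           t \<longlonglongrightarrow> 0 \<and> d' \<longlonglongrightarrow> d)}"

text \<open>\<open>crit_cone K x v\<close> is \<open>\<C>\<^sub>K(x, v) = \<T>\<^sub>K(x) \<inter> v\<^sup>\<bottom>\<close>.\<close>

definition crit_cone :: "'a::euclidean_space set \<Rightarrow> 'a \<Rightarrow> 'a \<Rightarrow> 'a set" where
  "crit_cone K x v = tangent_cone K x \<inter> {d. d \<bullet> v = 0}"

definition epideriv :: "('a::euclidean_space \<Rightarrow> ereal) \<Rightarrow> 'a \<Rightarrow> 'a \<Rightarrow> ereal" where
  "epideriv f x d =
     Liminf (at_right (0::real) \<times>\<^sub>F nhds d)
       (\<lambda>(t, d'). (f (x + t *\<^sub>R d') - f x) / ereal t)"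

text \<open>Only meaningful when \<open>f x\<close> and \<open>epideriv f x d\<close> are finite.\<close>

definition second_epideriv ::
  "('a::euclidean_space \<Rightarrow> ereal) \<Rightarrow> 'a \<Rightarrow> 'a \<Rightarrow> 'a \<Rightarrow> ereal" where
  "second_epideriv f x d w =
     Liminf (at_right (0::real) \<times>\<^sub>F nhds w)
       (\<lambda>(t, w'). (f (x + t *\<^sub>R d + (t\<^sup>2 / 2) *\<^sub>R w') - f x - ereal t * epideriv f x d)
                    / ereal (t\<^sup>2 / 2))"

definition fun_crit_cone :: "('a::euclidean_space \<Rightarrow> ereal) \<Rightarrow> 'a \<Rightarrow> 'a \<Rightarrow> 'a set" where
  "fun_crit_cone f x v = {d. epideriv f x d = ereal (d \<bullet> v)}"

text \<open>Real \<open>m \<times> n\<close> matrices are elements of \<open>real ^ 'n ^ 'm\<close>, whose inner product is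
  the trace inner product. The singular values of \<open>A\<close> are the numbers \<open>s \<ge> 0\<close> such
  that \<open>s\<^sup>2\<close> is an eigenvalue of \<open>A\<^sup>T A\<close>; the multiplicity of \<open>s\<close> is the dimension of
  the eigenspace (the multiplicity of \<open>s = 0\<close> is irrelevant for the sum).\<close>

definition sv_space :: "real ^ 'n ^ 'm \<Rightarrow> real \<Rightarrow> (real ^ 'n) set" where
  "sv_space A s = {v. (transpose A ** A) *v v = s\<^sup>2 *\<^sub>R v}"

definition singular_values :: "real ^ 'n ^ 'm \<Rightarrow> real set" where
  "singular_values A = {s. 0 \<le> s \<and> sv_space A s \<noteq> {0}}"

definition nuclear_norm :: "real ^ 'n ^ 'm \<Rightarrow> real" where
  "nuclear_norm A = (\<Sum>s\<in>singular_values A. real (dim (sv_space A s)) * s)"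

definition spectral_norm :: "real ^ 'n ^ 'm \<Rightarrow> real" where
  "spectral_norm A = onorm (\<lambda>v. A *v v)"

definition theta :: "real ^ 'n ^ 'm \<Rightarrow> ereal" where
  "theta X = ereal (nuclear_norm X)"

definition primal_obj ::
  "('d::euclidean_space \<Rightarrow> ereal) \<Rightarrow> (real ^ 'n ^ 'm \<Rightarrow> 'd) \<Rightarrow> real ^ 'n ^ 'm \<Rightarrow>
   real ^ 'n ^ 'm \<Rightarrow> ereal" where
  "primal_obj h \<F> C X = h (\<F> X) + ereal (C \<bullet> X) + ereal (nuclear_norm X)"

definition primal_feasible ::
  "(real ^ 'n ^ 'm \<Rightarrow> 'e::euclidean_space) \<Rightarrow> 'e \<Rightarrow> 'e set \<Rightarrow> (real ^ 'n ^ 'm) set" where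
  "primal_feasible \<A> b Q = {X. \<A> X - b \<in> Q}"

definition primal_solutions ::
  "('d::euclidean_space \<Rightarrow> ereal) \<Rightarrow> (real ^ 'n ^ 'm \<Rightarrow> 'd) \<Rightarrow>
   (real ^ 'n ^ 'm \<Rightarrow> 'e::euclidean_space) \<Rightarrow> real ^ 'n ^ 'm \<Rightarrow> 'e \<Rightarrow> 'e set \<Rightarrow>
   (real ^ 'n ^ 'm) set" where
  "primal_solutions h \<F> \<A> C b Q =
     {X \<in> primal_feasible \<A> b Q. primal_obj h \<F> C X < \<infinity> \<and>
        (\<forall>X' \<in> primal_feasible \<A> b Q. primal_obj h \<F> C X \<le> primal_obj h \<F> C X')}"

definition dual_obj ::
  "('d::euclidean_space \<Rightarrow> ereal) \<Rightarrow> 'e::euclidean_space \<Rightarrow> 'e set \<Rightarrow> 'e \<Rightarrow> 'd \<Rightarrow> ereal" where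
  "dual_obj h b Q y w =
     ereal (- (b \<bullet> y)) - indicator_fun (polar_cone Q) y - fenchel_conj h w"

definition dual_feasible ::
  "(real ^ 'n ^ 'm \<Rightarrow> 'd::euclidean_space) \<Rightarrow> (real ^ 'n ^ 'm \<Rightarrow> 'e::euclidean_space) \<Rightarrow>
   real ^ 'n ^ 'm \<Rightarrow> ('e \<times> 'd \<times> (real ^ 'n ^ 'm)) set" where
  "dual_feasible \<F> \<A> C =
     {(y, w, S). adjoint \<A> y + adjoint \<F> w + S + C = 0 \<and> spectral_norm S \<le> 1}"

definition dual_solutions ::
  "('d::euclidean_space \<Rightarrow> ereal) \<Rightarrow> (real ^ 'n ^ 'm \<Rightarrow> 'd) \<Rightarrow>
   (real ^ 'n ^ 'm \<Rightarrow> 'e::euclidean_space) \<Rightarrow> real ^ 'n ^ 'm \<Rightarrow> 'e \<Rightarrow> 'e set \<Rightarrow>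
   ('e \<times> 'd \<times> (real ^ 'n ^ 'm)) set" where
  "dual_solutions h \<F> \<A> C b Q =
     {(y, w, S) \<in> dual_feasible \<F> \<A> C. dual_obj h b Q y w > -\<infinity> \<and>
        (\<forall>(y', w', S') \<in> dual_feasible \<F> \<A> C. dual_obj h b Q y' w' \<le> dual_obj h b Q y w)}"

definition dual_multipliers ::
  "('d::euclidean_space \<Rightarrow> ereal) \<Rightarrow> (real ^ 'n ^ 'm \<Rightarrow> 'd) \<Rightarrow>
   (real ^ 'n ^ 'm \<Rightarrow> 'e::euclidean_space) \<Rightarrow> real ^ 'n ^ 'm \<Rightarrow> 'e \<Rightarrow> 'e set \<Rightarrow>
   'e \<Rightarrow> 'd \<Rightarrow> real ^ 'n ^ 'm \<Rightarrow> (real ^ 'n ^ 'm) set" where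
  "dual_multipliers h \<F> \<A> C b Q y w S =
     {X. \<A> X - b \<in> normal_cone (polar_cone Q) y \<and>
         \<F> X \<in> subdiff (fenchel_conj h) w \<and>
         X \<in> subdiff (fenchel_conj theta) S \<and>
         adjoint \<A> y + adjoint \<F> w + S + C = 0}"

definition dual_critical_cone ::
  "(real ^ 'n ^ 'm \<Rightarrow> 'd::euclidean_space) \<Rightarrow> (real ^ 'n ^ 'm \<Rightarrow> 'e::euclidean_space) \<Rightarrow>
   'e \<Rightarrow> 'e set \<Rightarrow> real ^ 'n ^ 'm \<Rightarrow> 'e \<Rightarrow> real ^ 'n ^ 'm \<Rightarrow>
   ('e \<times> 'd \<times> (real ^ 'n ^ 'm)) set" where
  "dual_critical_cone \<F> \<A> b Q X y S =
     {(Hy, Hw, HS). adjoint \<A> Hy + adjoint \<F> Hw + HS = 0 \<and>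
        Hy \<in> crit_cone (polar_cone Q) y (\<A> X - b) \<and>
        HS \<in> fun_crit_cone (fenchel_conj theta) S X}"

text \<open>On the critical cone the first epiderivative of \<open>\<theta>\<^sup>*\<close> is finite, and
  \<open>\<phi>\<^sup>*\<close> never takes the value \<open>\<infinity>\<close> at \<open>X\<close>, but may a priori be \<open>-\<infinity>\<close>; hence the
  quadratic form is compared in the extended reals.\<close>

definition dual_SOSC ::
  "('d::euclidean_space \<Rightarrow> ereal) \<Rightarrow> (real ^ 'n ^ 'm \<Rightarrow> 'd) \<Rightarrow>
   (real ^ 'n ^ 'm \<Rightarrow> 'e::euclidean_space) \<Rightarrow> 'e \<Rightarrow> 'e set \<Rightarrow>
   real ^ 'n ^ 'm \<Rightarrow> 'e \<Rightarrow> 'd \<Rightarrow> real ^ 'n ^ 'm \<Rightarrow> bool" where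
  "dual_SOSC h \<F> \<A> b Q X y w S \<longleftrightarrow>
     (\<forall>(Hy, Hw, HS) \<in> dual_critical_cone \<F> \<A> b Q X y S - {0}.
        ereal (Hw \<bullet> dir_deriv (grad (fenchel_conj h)) w Hw)
          - fenchel_conj (second_epideriv (fenchel_conj theta) S HS) X > 0)"

text \<open>The sum is the Minkowski sum of sets in the product space.\<close>

definition primal_SRCQ ::
  "(real ^ 'n ^ 'm \<Rightarrow> 'e::euclidean_space) \<Rightarrow> 'e \<Rightarrow> 'e set \<Rightarrow>
   real ^ 'n ^ 'm \<Rightarrow> 'e \<Rightarrow> real ^ 'n ^ 'm \<Rightarrow> bool" where
  "primal_SRCQ \<A> b Q X y S \<longleftrightarrow>
     range (\<lambda>Z. (\<A> Z, Z)) + (crit_cone Q (\<A> X - b) y \<times> fun_crit_cone theta X S) = UNIV"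

end

theory Submission
  imports Defs
begin

text \<open>
  Both conditions fail for the same reason: the existence of \<open>H\<^sub>y \<noteq> 0\<close> in the polar of
  \<open>\<C>\<^sub>Q(\<A> X - b, y)\<close> such that \<open>- \<A>\<^sup>* H\<^sub>y\<close> lies in the polar of \<open>\<C>\<^sub>\<theta>(X, S)\<close>.

  For the strict Robinson condition this is a separation argument. Eliminating the variable of the
  second block, the condition says that the convex cone \<open>\<C>\<^sub>Q - \<A> \<C>\<^sub>\<theta>\<close> is the whole space, and in
  finite dimension a convex cone other than the whole space lies in a closed half-space
  (\<open>cone_qualification_iff_polar_trivial\<close>).

  For the second order condition, both terms of the quadratic form are nonnegative on the critical
  cone, so that it fails at a direction exactly when both terms vanish there. The first term is
  positive unless \<open>H\<^sub>w = 0\<close>: the gradient of \<open>h\<^sup>*\<close> is a right inverse of the gradient of \<open>h\<close>, so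
  the Hessian of \<open>h\<close> maps \<open>(\<nabla>h\<^sup>*)'(w; H\<^sub>w)\<close> to \<open>H\<^sub>w\<close>, and a positive semidefinite form is positive
  at the vectors that its operator does not annihilate (\<open>conjugate_curvature_positive\<close>). The
  second term vanishes exactly when \<open>H\<^sub>S\<close> is in the polar of \<open>\<C>\<^sub>\<theta>(X, S)\<close>
  (\<open>conj_second_epideriv_theta\<close>). Since \<open>H\<^sub>w = 0\<close> forces \<open>H\<^sub>S = - \<A>\<^sup>* H\<^sub>y\<close>, and since the
  critical cone of \<open>Q\<^sup>\<circ>\<close> is the polar of that of the polyhedral cone \<open>Q\<close>
  (\<open>crit_cone_polar_polyhedron\<close>), the failing directions are those described above.

  The statement on the second term is the heart of the matter. Choose an orthonormal basis \<open>V\<close>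
  whose images under \<open>X\<close> are pairwise orthogonal. Then \<open>\<parallel>X\<parallel>\<^sub>* = \<Sum>v\<in>V. \<parallel>X v\<parallel>\<close>, and the face \<open>F\<close> of
  the spectral unit ball exposed by \<open>X\<close>, to which \<open>S\<close> belongs, consists of the matrices of the ball
  that map \<open>v\<close> to \<open>X v / \<parallel>X v\<parallel>\<close> whenever \<open>X v \<noteq> 0\<close>. The cone \<open>\<C>\<^sub>\<theta>(X, S)\<close> is the normal cone of \<open>F\<close>
  at \<open>S\<close>, and testing with matrices of rank one shows that its polar consists of the directions
  \<open>H\<close> that are tangent to the ball at \<open>S\<close> and vanish on the row and column spaces of \<open>X\<close>
  (\<open>polar_fun_crit_cone_theta\<close>). On the other hand the second term is \<open>- sup \<langle>W, X\<rangle>\<close> over the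
  second order tangent directions \<open>W\<close> of the ball. Expanding \<open>\<parallel>(S + t H + t\<^sup>2/2 W) v\<parallel> \<le> \<parallel>v\<parallel>\<close> to second
  order gives \<open>\<langle>W v, X v\<rangle> \<le> - \<parallel>X v\<parallel> \<parallel>H v\<parallel>\<^sup>2\<close>, and similarly for the transpose, hence the supremum
  can only be zero if \<open>H\<close> vanishes on these spaces. Conversely, for such an \<open>H\<close> the matrix
  \<open>S + t H\<close> exceeds norm one by at most a factor \<open>1 + c t\<^sup>2\<close>; shrinking only its action on the kernel
  of \<open>X\<close> gives a curve in \<open>F\<close> whose second order term is orthogonal to \<open>X\<close>
  (\<open>curve_in_face\<close>).
\<close>

section \<open>Singular bases and the nuclear norm\<close>

lemma orthonormal_expansion:
  fixes x :: "'a::euclidean_space"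
  assumes orth: "pairwise orthogonal V" "\<And>v. v \<in> V \<Longrightarrow> norm v = 1" and x: "x \<in> span V"
  shows "x = (\<Sum>v\<in>V. (x \<bullet> v) *\<^sub>R v)"
proof -
  have fin: "finite V"
    using pairwise_orthogonal_imp_finite orth by auto
  let ?d = "x - (\<Sum>v\<in>V. (x \<bullet> v) *\<^sub>R v)"
  have "?d \<bullet> u = 0" if u: "u \<in> V" for u
  proof -
    have "(\<Sum>v\<in>V. (x \<bullet> v) *\<^sub>R v) \<bullet> u = (\<Sum>v\<in>V. (x \<bullet> v) * (v \<bullet> u))"
      by (simp add: inner_sum_left)
    also have "\<dots> = (\<Sum>v\<in>V. if v = u then x \<bullet> u else 0)"
      using orth u by (intro sum.cong) (auto simp: pairwise_def orthogonal_def dot_square_norm)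
    also have "\<dots> = x \<bullet> u" using fin u by simp
    finally show ?thesis by (simp add: inner_diff_left)
  qed
  then have "orthogonal ?d u" if "u \<in> span V" for u
    using that by (intro orthogonal_to_span[of u V]) (auto simp: orthogonal_def)
  moreover have "?d \<in> span V"
    using x by (intro span_diff span_sum span_scale) (auto intro: span_base)
  ultimately have "?d = 0" by (metis orthogonal_self)
  then show ?thesis by simp
qed

lemma orthonormal_inner_expansion:
  fixes x z :: "'a::euclidean_space"
  assumes "pairwise orthogonal V" "\<And>v. v \<in> V \<Longrightarrow> norm v = 1" "x \<in> span V"
  shows "x \<bullet> z = (\<Sum>v\<in>V. (x \<bullet> v) * (v \<bullet> z))"
  by (subst orthonormal_expansion[OF assms]) (simp_all add: inner_sum_left)

text \<open>
  First order optimality: as \<open>z\<close> is orthogonal to \<open>v\<close>, the square of the right side of the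
  inequality has no term linear in \<open>s\<close>, so the one of the left side has to vanish as well.
\<close>
lemma maximal_image_orthogonal:
  fixes f :: "'a::euclidean_space \<Rightarrow> 'b::euclidean_space"
  assumes f: "linear f" and v: "norm v = 1" and z: "orthogonal v z"
    and max: "\<And>s. norm (f (v + s *\<^sub>R z)) \<le> norm (f v) * norm (v + s *\<^sub>R z)"
  shows "f v \<bullet> f z = 0"
proof (rule ccontr)
  assume ne: "f v \<bullet> f z \<noteq> 0"
  define c where "c = f v \<bullet> f z"
  define K where "K = (norm (f v))\<^sup>2 * (norm z)\<^sup>2 + 1"
  have K: "K > 0" unfolding K_def by (simp add: add_nonneg_pos)
  \<comment> \<open>This step makes the linear term \<open>2 s c\<close> twice as large as the bound \<open>s\<^sup>2 K\<close> on the quadratic ones.\<close>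
  define s where "s = c / K"
  have "(norm (f (v + s *\<^sub>R z)))\<^sup>2 \<le> (norm (f v) * norm (v + s *\<^sub>R z))\<^sup>2"
    using max by (intro power_mono) auto
  moreover have "(norm (v + s *\<^sub>R z))\<^sup>2 = 1 + s\<^sup>2 * (norm z)\<^sup>2"
    using z v by (simp add: norm_add_Pythagorean orthogonal_def power_mult_distrib)
  moreover have "(norm (f (v + s *\<^sub>R z)))\<^sup>2 = (norm (f v))\<^sup>2 + 2 * s * c + s\<^sup>2 * (norm (f z))\<^sup>2"
    unfolding c_def power2_norm_eq_inner
    by (simp add: linear_add[OF f] linear_cmul[OF f] inner_add algebra_simps inner_commute power2_eq_square)
  ultimately have "2 * s * c + s\<^sup>2 * (norm (f z))\<^sup>2 \<le> s\<^sup>2 * ((norm (f v))\<^sup>2 * (norm z)\<^sup>2)"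
    by (simp add: power_mult_distrib algebra_simps)
  then have "2 * s * c \<le> s\<^sup>2 * (K - 1)"
    unfolding K_def by (smt (verit) zero_le_mult_iff zero_le_power2)
  moreover have "s\<^sup>2 * (K - 1) \<le> s\<^sup>2 * K" by (simp add: mult_left_mono)
  moreover have "s\<^sup>2 * K = s * c" using K by (simp add: s_def power2_eq_square)
  ultimately have "s * c \<le> 0" by linarith
  moreover have "s * c > 0" using ne K by (simp add: s_def c_def flip: power2_eq_square)
  ultimately show False by simp
qed

text \<open>
  Singular value decomposition without eigenvalues: pick a unit vector \<open>v\<close> of \<open>W\<close> maximising \<open>\<parallel>f v\<parallel>\<close>
  and recurse on its orthogonal complement in \<open>W\<close>. By optimality, \<open>f v\<close> is orthogonal to the image of
  the whole complement, so no invariance of the subspaces has to be maintained.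
\<close>
lemma linear_image_orthogonal_basis:
  fixes f :: "'a::euclidean_space \<Rightarrow> 'b::euclidean_space"
  assumes f: "linear f" and W: "subspace W"
  shows "\<exists>V \<subseteq> W. pairwise orthogonal V \<and> (\<forall>v\<in>V. norm v = 1) \<and> span V = W \<and>
           (\<forall>v\<in>V. \<forall>u\<in>V. v \<noteq> u \<longrightarrow> f v \<bullet> f u = 0)"
  using W
proof (induction "dim W" arbitrary: W rule: less_induct)
  case less
  note W = \<open>subspace W\<close>
  show ?case
  proof (cases "W = {0}")
    case True
    then show ?thesis by (intro exI[of _ "{}"]) auto
  next
    case False
    let ?K = "W \<inter> sphere 0 1"
    obtain x where x: "x \<in> W" "x \<noteq> 0" using False subspace_0[OF W] by auto
    have "x /\<^sub>R norm x \<in> ?K" using x W by (simp add: subspace_scale)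
    moreover have "compact ?K" using closed_subspace[OF W] by (simp add: closed_Int_compact)
    moreover have "continuous_on ?K (\<lambda>z. norm (f z))"
      using f by (intro continuous_on_norm linear_continuous_on) (simp add: linear_conv_bounded_linear)
    ultimately obtain v where v: "v \<in> ?K" and vmax: "\<And>z. z \<in> ?K \<Longrightarrow> norm (f z) \<le> norm (f v)"
      using continuous_attains_sup[of ?K "\<lambda>z. norm (f z)"] by blast
    have max: "norm (f z) \<le> norm (f v) * norm z" if "z \<in> W" for z
    proof (cases "z = 0")
      case False
      then have "norm (f (z /\<^sub>R norm z)) \<le> norm (f v)"
        using that W by (intro vmax) (simp add: subspace_scale)
      then show ?thesis using False by (simp add: linear_cmul[OF f] field_simps)
    qed (simp add: linear_0[OF f])
    define W' where "W' = W \<inter> {z. orthogonal v z}"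
    have W': "subspace W'" unfolding W'_def using W subspace_orthogonal_to_vector
      by (intro subspace_inter) 
    have "v \<notin> W'" using v by (auto simp: W'_def orthogonal_def)
    then have "W' \<subset> W" using v by (auto simp: W'_def)
    then have "dim W' < dim W" using W W' by (metis dim_psubset span_eq_iff)
    then obtain V' where V': "V' \<subseteq> W'" "pairwise orthogonal V'" "\<forall>v\<in>V'. norm v = 1" "span V' = W'"
      "\<forall>v\<in>V'. \<forall>u\<in>V'. v \<noteq> u \<longrightarrow> f v \<bullet> f u = 0" using less.hyps W' by meson
    have fv: "f v \<bullet> f z = 0" if "z \<in> W'" for z
    proof (rule maximal_image_orthogonal[OF f])
      show "norm v = 1" "orthogonal v z" using v that by (auto simp: W'_def)
      show "norm (f (v + s *\<^sub>R z)) \<le> norm (f v) * norm (v + s *\<^sub>R z)" for s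
        using that v W by (intro max) (auto simp: W'_def subspace_add subspace_scale)
    qed
    have "W \<subseteq> span (insert v V')"
    proof
      fix z assume z: "z \<in> W"
      have "z - (z \<bullet> v) *\<^sub>R v \<in> W'"
        using z v W unfolding W'_def
        by (auto simp: subspace_diff subspace_scale orthogonal_def inner_diff_right dot_square_norm inner_commute)
      then show "z \<in> span (insert v V')" using V' by (auto simp: span_insert)
    qed
    moreover have "span (insert v V') \<subseteq> W"
      using v V' W by (intro span_minimal) (auto simp: W'_def)
    ultimately have "span (insert v V') = W" by blast
    moreover have "pairwise orthogonal (insert v V')"
      using V' by (auto simp: pairwise_insert W'_def orthogonal_commute)
    moreover have "\<forall>u\<in>insert v V'. \<forall>u'\<in>insert v V'. u \<noteq> u' \<longrightarrow> f u \<bullet> f u' = 0"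
      using V' fv by (metis inner_commute insert_iff subsetD)
    moreover have "insert v V' \<subseteq> W" "\<forall>u\<in>insert v V'. norm u = 1" using v V' by (auto simp: W'_def)
    ultimately show ?thesis by blast
  qed
qed

text \<open>
  These are the right singular vectors of \<open>X\<close>, with the unit vectors of the kernel included;
  \<open>X v\<close> is the left singular vector scaled by the singular value. Keeping the values \<open>X v\<close> instead
  of normalised left vectors avoids a case distinction on the rank.
\<close>
definition singular_basis :: "real ^ 'n ^ 'm \<Rightarrow> (real ^ 'n) set \<Rightarrow> bool" where
  "singular_basis X V \<longleftrightarrow>
     pairwise orthogonal V \<and> (\<forall>v\<in>V. norm v = 1) \<and> span V = UNIV \<and>
     (\<forall>v\<in>V. \<forall>u\<in>V. v \<noteq> u \<longrightarrow> (X *v v) \<bullet> (X *v u) = 0)"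

lemma singular_basis_exists: "\<exists>V. singular_basis (X :: real ^ 'n ^ 'm) V"
  using linear_image_orthogonal_basis[OF matrix_vector_mul_linear subspace_UNIV, of X]
  unfolding singular_basis_def by auto

lemma singular_basis_finite: "singular_basis X V \<Longrightarrow> finite V"
  unfolding singular_basis_def using pairwise_orthogonal_imp_finite by auto

lemma singular_basis_eigenvector:
  fixes X :: "real ^ 'n ^ 'm"
  assumes V: "singular_basis X V" and v: "v \<in> V"
  shows "(transpose X ** X) *v v = (norm (X *v v))\<^sup>2 *\<^sub>R v"
proof -
  have "((transpose X ** X) *v v) \<bullet> u = ((norm (X *v v))\<^sup>2 *\<^sub>R v) \<bullet> u" if u: "u \<in> V" for u
  proof -
    have "((transpose X ** X) *v v) \<bullet> u = (X *v v) \<bullet> (X *v u)"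
      by (simp add: dot_lmul_matrix flip: matrix_vector_mul_assoc)
    also have "\<dots> = ((norm (X *v v))\<^sup>2 *\<^sub>R v) \<bullet> u"
      using V u v by (cases "u = v") (auto simp: singular_basis_def pairwise_def orthogonal_def dot_square_norm)
    finally show ?thesis .
  qed
  then have "orthogonal ((transpose X ** X) *v v - (norm (X *v v))\<^sup>2 *\<^sub>R v) u" if "u \<in> V" for u
    using that by (simp add: orthogonal_def inner_diff_left)
  then have "orthogonal ((transpose X ** X) *v v - (norm (X *v v))\<^sup>2 *\<^sub>R v) u" for u
    using orthogonal_to_span[of u V] V by (auto simp: singular_basis_def)
  then show ?thesis by (metis orthogonal_self right_minus_eq)
qed

text \<open>
  An eigenvector of \<open>X\<^sup>T X\<close> is orthogonal to the basis vectors with another eigenvalue, so it is a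
  combination of those with the same one. This turns multiplicities into numbers of basis vectors.
\<close>
lemma singular_basis_sv_space:
  fixes X :: "real ^ 'n ^ 'm"
  assumes V: "singular_basis X V" and s: "0 \<le> s"
  shows "sv_space X s = span {v \<in> V. norm (X *v v) = s}"
proof
  let ?M = "transpose X ** X"
  have sub: "subspace (sv_space X s)"
    by (auto simp: subspace_def sv_space_def matrix_vector_right_distrib scaleR_right_distrib
         matrix_vector_mult_scaleR algebra_simps)
  show "span {v \<in> V. norm (X *v v) = s} \<subseteq> sv_space X s"
    using singular_basis_eigenvector[OF V] by (intro span_minimal sub) (auto simp: sv_space_def)
  show "sv_space X s \<subseteq> span {v \<in> V. norm (X *v v) = s}"
  proof
    fix x assume x: "x \<in> sv_space X s"
    have zero: "x \<bullet> v = 0" if v: "v \<in> V" and ne: "norm (X *v v) \<noteq> s" for v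
    proof -
      have "(?M *v x) \<bullet> v = x \<bullet> (?M *v v)"
        by (metis dot_lmul_matrix matrix_transpose_mul transpose_matrix_vector transpose_transpose)
      then have "s\<^sup>2 * (x \<bullet> v) = (norm (X *v v))\<^sup>2 * (x \<bullet> v)"
        using x singular_basis_eigenvector[OF V v] by (simp add: sv_space_def)
      moreover have "s\<^sup>2 \<noteq> (norm (X *v v))\<^sup>2" using ne s by simp
      ultimately show ?thesis by simp
    qed
    have "x = (\<Sum>v\<in>V. (x \<bullet> v) *\<^sub>R v)"
      using V by (intro orthonormal_expansion) (auto simp: singular_basis_def)
    also have "\<dots> \<in> span {v \<in> V. norm (X *v v) = s}"
    proof (rule span_sum)
      fix v assume "v \<in> V"
      then show "(x \<bullet> v) *\<^sub>R v \<in> span {v \<in> V. norm (X *v v) = s}"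
        using zero by (cases "norm (X *v v) = s") (simp_all add: span_scale span_base span_zero)
    qed
    finally show "x \<in> span {v \<in> V. norm (X *v v) = s}" .
  qed
qed

lemma nuclear_norm_singular_basis:
  fixes X :: "real ^ 'n ^ 'm"
  assumes V: "singular_basis X V"
  shows "nuclear_norm X = (\<Sum>v\<in>V. norm (X *v v))"
proof -
  note fin = singular_basis_finite[OF V]
  have ne0: "v \<noteq> 0" if "v \<in> V" for v using V that by (auto simp: singular_basis_def)
  have indep: "independent V"
    using V ne0 by (intro pairwise_orthogonal_independent) (auto simp: singular_basis_def)
  have dim: "dim (sv_space X s) = card {v \<in> V. norm (X *v v) = s}" if "0 \<le> s" for s
    unfolding singular_basis_sv_space[OF V that] dim_span
    using independent_mono[OF indep, of "{v \<in> V. norm (X *v v) = s}"] by (intro dim_eq_card_independent) auto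
  have sv: "singular_values X = (\<lambda>v. norm (X *v v)) ` V" (is "_ = ?R")
  proof
    show "singular_values X \<subseteq> ?R"
    proof
      fix s assume "s \<in> singular_values X"
      then have s: "0 \<le> s" "sv_space X s \<noteq> {0}" by (auto simp: singular_values_def)
      then have "{v \<in> V. norm (X *v v) = s} \<noteq> {}"
        using singular_basis_sv_space[OF V s(1)] by (metis span_empty)
      then show "s \<in> ?R" by auto
    qed
    show "?R \<subseteq> singular_values X"
    proof
      fix s assume "s \<in> ?R"
      then obtain v where v: "v \<in> V" "s = norm (X *v v)" by auto
      then have "v \<in> sv_space X s"
        using singular_basis_eigenvector[OF V] by (simp add: sv_space_def)
      then show "s \<in> singular_values X" using v ne0 by (auto simp: singular_values_def)
    qed
  qed
  have "nuclear_norm X = (\<Sum>s\<in>?R. \<Sum>v\<in>{v \<in> V. norm (X *v v) = s}. norm (X *v v))"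
    unfolding nuclear_norm_def sv by (intro sum.cong) (auto simp: dim)
  also have "\<dots> = (\<Sum>v\<in>V. norm (X *v v))"
    using fin by (intro sum.group) auto
  finally show ?thesis .
qed

lemma singular_basis_inner:
  fixes X G :: "real ^ 'n ^ 'm"
  assumes V: "singular_basis X V"
  shows "G \<bullet> X = (\<Sum>v\<in>V. (G *v v) \<bullet> (X *v v))"
proof -
  have "G $ i \<bullet> X $ i = (\<Sum>v\<in>V. (G $ i \<bullet> v) * (v \<bullet> X $ i))" for i
    using V by (intro orthonormal_inner_expansion) (auto simp: singular_basis_def)
  then have "G \<bullet> X = (\<Sum>i\<in>UNIV. \<Sum>v\<in>V. (G $ i \<bullet> v) * (v \<bullet> X $ i))"
    by (simp add: inner_vec_def)
  also have "\<dots> = (\<Sum>v\<in>V. \<Sum>i\<in>UNIV. (G $ i \<bullet> v) * (v \<bullet> X $ i))"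
    by (rule sum.swap)
  also have "\<dots> = (\<Sum>v\<in>V. (G *v v) \<bullet> (X *v v))"
    by (simp add: inner_vec_def matrix_vector_mult_def inner_commute mult.commute)
  finally show ?thesis .
qed

section \<open>The spectral ball and its faces\<close>

definition spec_ball :: "(real ^ 'n ^ 'm) set" where
  "spec_ball = {G. spectral_norm G \<le> 1}"

lemma spec_ball_iff: "G \<in> spec_ball \<longleftrightarrow> (\<forall>v. norm (G *v v) \<le> norm v)"
proof -
  have bl: "bounded_linear ((*v) G)" by (simp add: linear_linear)
  have "norm (G *v v) \<le> norm v" if "onorm ((*v) G) \<le> 1" for v
    using onorm[OF bl, of v] mult_right_mono[OF that, of "norm v"] by simp
  then show ?thesis
    unfolding spec_ball_def spectral_norm_def by (auto intro!: onorm_le)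
qed

lemma spec_ball_bilinear:
  assumes "G \<in> spec_ball"
  shows "a \<bullet> (G *v z) \<le> norm a * norm z"
proof -
  have "a \<bullet> (G *v z) \<le> norm a * norm (G *v z)" by (rule norm_cauchy_schwarz)
  also have "\<dots> \<le> norm a * norm z" using assms by (intro mult_left_mono) (auto simp: spec_ball_iff)
  finally show ?thesis .
qed

lemma spec_ball_vector_matrix:
  assumes "G \<in> spec_ball"
  shows "norm (a v* G) \<le> norm a"
proof -
  have "(norm (a v* G))\<^sup>2 = a \<bullet> (G *v (a v* G))" by (simp add: power2_norm_eq_inner dot_lmul_matrix)
  also have "\<dots> \<le> norm a * norm (a v* G)" by (rule spec_ball_bilinear[OF assms])
  finally show ?thesis by (cases "norm (a v* G) = 0") (auto simp: power2_eq_square)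
qed

lemma inner_matrix_rows: "(G :: real ^ 'n ^ 'm) \<bullet> D = (\<Sum>i\<in>UNIV. G $ i \<bullet> D $ i)"
  by (simp add: inner_vec_def)

definition outer :: "real ^ 'm \<Rightarrow> real ^ 'n \<Rightarrow> real ^ 'n ^ 'm" where
  "outer a z = (\<chi> i. a $ i *\<^sub>R z)"

lemma inner_outer: "G \<bullet> outer a z = a \<bullet> (G *v z)"
  by (simp add: inner_matrix_rows outer_def inner_vec_def[of a] matrix_vector_mult_def inner_vec_def[of _ z] mult.commute)

lemma outer_mult: "outer a z *v x = (z \<bullet> x) *\<^sub>R a"
  by (simp add: vec_eq_iff outer_def matrix_vector_mult_def inner_vec_def sum_distrib_left mult_ac)

lemma spec_ball_compact: "compact (spec_ball :: (real ^ 'n ^ 'm) set)"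
proof -
  have eq: "spec_ball = (\<Inter>v. {G :: real ^ 'n ^ 'm. norm (G *v v) \<le> norm v})"
    by (auto simp: spec_ball_iff)
  have "continuous_on UNIV (\<lambda>G :: real ^ 'n ^ 'm. G *v v)" for v
    by (intro linear_continuous_on linear_conv_bounded_linear[THEN iffD1] linearI)
      (simp_all add: matrix_vector_mult_add_rdistrib scaleR_matrix_vector_assoc)
  then have "closed (spec_ball :: (real ^ 'n ^ 'm) set)"
    unfolding eq by (intro closed_INT ballI closed_Collect_le continuous_intros)
  moreover have "bounded (spec_ball :: (real ^ 'n ^ 'm) set)"
    unfolding bounded_iff
  proof (intro exI ballI)
    fix G :: "real ^ 'n ^ 'm" assume G: "G \<in> spec_ball"
    have "norm G \<le> (\<Sum>i\<in>UNIV. norm (G $ i))" by (simp add: norm_vec_def L2_set_le_sum)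
    also have "\<dots> \<le> (\<Sum>i\<in>(UNIV :: 'm set). 1)"
    proof (rule sum_mono)
      fix i
      have "axis i 1 v* G = G $ i"
        by (simp add: vec_eq_iff vector_matrix_mult_def axis_def mult_delta_left mult_delta_right)
      then show "norm (G $ i) \<le> 1" using spec_ball_vector_matrix[OF G, of "axis i 1"] by simp
    qed
    finally show "norm G \<le> (\<Sum>i\<in>(UNIV :: 'm set). 1)" .
  qed
  ultimately show ?thesis by (simp add: compact_eq_bounded_closed)
qed

text \<open>
  One half of the duality between the nuclear and the spectral norm: each basis vector contributes
  at most \<open>\<parallel>X v\<parallel>\<close> to the trace of \<open>G\<^sup>T X\<close>. The polar factor below attains the bound.
\<close>
lemma spec_ball_inner_le_nuclear_norm:
  assumes G: "G \<in> spec_ball"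
  shows "G \<bullet> X \<le> nuclear_norm X"
proof -
  obtain V where V: "singular_basis X V" using singular_basis_exists by blast
  have "(G *v v) \<bullet> (X *v v) \<le> norm (X *v v)" if "v \<in> V" for v
    using spec_ball_bilinear[OF G, of "X *v v" v] V that by (simp add: inner_commute singular_basis_def)
  then show ?thesis
    unfolding singular_basis_inner[OF V] nuclear_norm_singular_basis[OF V] by (rule sum_mono)
qed

text \<open>
  For a singular basis this is the partial isometry of the polar decomposition of \<open>X\<close>. On the kernel of \<open>X\<close> it vanishes, because
  the inverse of zero is zero.
\<close>
definition polar_factor :: "real ^ 'n ^ 'm \<Rightarrow> (real ^ 'n) set \<Rightarrow> real ^ 'n ^ 'm" where
  "polar_factor X V = (\<Sum>v\<in>V. outer ((X *v v) /\<^sub>R norm (X *v v)) v)"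

lemma polar_factor_mult: "polar_factor X V *v x = (\<Sum>v\<in>V. (v \<bullet> x) *\<^sub>R ((X *v v) /\<^sub>R norm (X *v v)))"
proof -
  have "finite V \<Longrightarrow> ?thesis"
    unfolding polar_factor_def
    by (induction V rule: finite_induct) (simp_all add: matrix_vector_mult_add_rdistrib outer_mult)
  then show ?thesis by (cases "finite V") (auto simp: polar_factor_def)
qed

lemma polar_factor_basis:
  assumes V: "singular_basis X V" and v: "v \<in> V"
  shows "polar_factor X V *v v = (X *v v) /\<^sub>R norm (X *v v)"
proof -
  have "polar_factor X V *v v = (\<Sum>u\<in>V. if u = v then (X *v v) /\<^sub>R norm (X *v v) else 0)"
    unfolding polar_factor_mult using V v
    by (intro sum.cong) (auto simp: singular_basis_def pairwise_def orthogonal_def dot_square_norm)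
  then show ?thesis using v singular_basis_finite[OF V] by simp
qed

lemma polar_factor_spec_ball:
  assumes V: "singular_basis X V"
  shows "polar_factor X V \<in> spec_ball"
  unfolding spec_ball_iff
proof
  fix x
  let ?u = "\<lambda>v. (X *v v) /\<^sub>R norm (X *v v)"
  note fin = singular_basis_finite[OF V]
  have "(norm (polar_factor X V *v x))\<^sup>2 = (\<Sum>v\<in>V. (norm ((v \<bullet> x) *\<^sub>R ?u v))\<^sup>2)"
    unfolding polar_factor_mult
    using V fin by (intro norm_sum_Pythagorean) (auto simp: pairwise_def orthogonal_def singular_basis_def)
  also have "\<dots> \<le> (\<Sum>v\<in>V. (v \<bullet> x)\<^sup>2)"
  proof (rule sum_mono)
    fix v
    have "norm (?u v) \<le> 1" by (cases "X *v v = 0") simp_all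
    then have "norm ((v \<bullet> x) *\<^sub>R ?u v) \<le> \<bar>v \<bullet> x\<bar>"
      using mult_left_le[of "norm (?u v)" "\<bar>v \<bullet> x\<bar>"] unfolding norm_scaleR by simp
    then show "(norm ((v \<bullet> x) *\<^sub>R ?u v))\<^sup>2 \<le> (v \<bullet> x)\<^sup>2"
      by (metis abs_le_square_iff abs_norm_cancel)
  qed
  also have "\<dots> = (norm x)\<^sup>2"
    unfolding power2_norm_eq_inner using V
    by (subst orthonormal_inner_expansion[of V]) (auto simp: singular_basis_def power2_eq_square inner_commute)
  finally show "norm (polar_factor X V *v x) \<le> norm x" by (simp add: power2_le_iff_abs_le)
qed

lemma polar_factor_inner:
  assumes V: "singular_basis X V"
  shows "polar_factor X V \<bullet> X = nuclear_norm X"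
  unfolding singular_basis_inner[OF V] nuclear_norm_singular_basis[OF V]
proof (intro sum.cong refl)
  fix v assume "v \<in> V"
  then show "(polar_factor X V *v v) \<bullet> (X *v v) = norm (X *v v)"
    by (cases "X *v v = 0") (simp_all add: polar_factor_basis[OF V] dot_square_norm power2_eq_square)
qed

lemma nuclear_norm_attained:
  obtains G where "G \<in> spec_ball" "G \<bullet> X = nuclear_norm X"
  using singular_basis_exists polar_factor_spec_ball polar_factor_inner by metis

lemma nuclear_norm_scaleR:
  assumes "0 \<le> c"
  shows "nuclear_norm (c *\<^sub>R X) = c * nuclear_norm X"
proof (rule antisym)
  obtain G where "G \<in> spec_ball" "G \<bullet> (c *\<^sub>R X) = nuclear_norm (c *\<^sub>R X)" by (rule nuclear_norm_attained)
  then show "nuclear_norm (c *\<^sub>R X) \<le> c * nuclear_norm X"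
    using spec_ball_inner_le_nuclear_norm[of G X] mult_left_mono[of "G \<bullet> X" "nuclear_norm X" c] assms by simp
  obtain G where "G \<in> spec_ball" "G \<bullet> X = nuclear_norm X" by (rule nuclear_norm_attained)
  then show "c * nuclear_norm X \<le> nuclear_norm (c *\<^sub>R X)"
    using spec_ball_inner_le_nuclear_norm[of G "c *\<^sub>R X"] by simp
qed

lemma nuclear_norm_outer_le: "nuclear_norm (outer a z) \<le> norm a * norm z"
proof -
  obtain G where "G \<in> spec_ball" "G \<bullet> outer a z = nuclear_norm (outer a z)" by (rule nuclear_norm_attained)
  then show ?thesis using spec_ball_bilinear[of G a z] by (simp add: inner_outer)
qed

text \<open>
  The nuclear norm is the support function of the spectral ball; outside of the ball, a vector that
  is stretched by \<open>G\<close> gives a matrix of rank one along which the supremum is infinite.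
\<close>
lemma fenchel_conj_theta: "fenchel_conj theta = indicator_fun (spec_ball :: (real ^ 'n ^ 'm) set)"
proof
  fix G :: "real ^ 'n ^ 'm"
  have conj: "fenchel_conj theta G = (SUP X. ereal (G \<bullet> X - nuclear_norm X))"
    by (simp add: fenchel_conj_def theta_def inner_commute)
  show "fenchel_conj theta G = indicator_fun spec_ball G"
  proof (cases "G \<in> spec_ball")
    case True
    have "(SUP X. ereal (G \<bullet> X - nuclear_norm X)) \<le> 0"
      using spec_ball_inner_le_nuclear_norm[OF True] by (intro SUP_least) simp
    moreover have "nuclear_norm (0 :: real ^ 'n ^ 'm) = 0" using nuclear_norm_scaleR[of 0 0] by simp
    then have "0 \<le> (SUP X. ereal (G \<bullet> X - nuclear_norm X))"
      by (intro SUP_upper2[of 0]) (auto simp: zero_ereal_def)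
    ultimately show ?thesis using True by (simp add: conj indicator_fun_def)
  next
    case False
    then obtain z where z: "norm z < norm (G *v z)" by (auto simp: spec_ball_iff not_le)
    let ?D = "outer (G *v z) z"
    define \<epsilon> where "\<epsilon> = G \<bullet> ?D - nuclear_norm ?D"
    have "norm (G *v z) * norm z < norm (G *v z) * norm (G *v z)"
      using z norm_ge_zero[of z] by (intro mult_strict_left_mono) linarith+
    then have \<epsilon>: "\<epsilon> > 0"
      using nuclear_norm_outer_le[of "G *v z" z]
      by (simp add: \<epsilon>_def inner_outer power2_norm_eq_inner[symmetric] power2_eq_square)
    have "(SUP X. ereal (G \<bullet> X - nuclear_norm X)) = \<infinity>"
    proof (rule SUP_PInfty)
      fix k
      show "\<exists>X\<in>UNIV. ereal (real k) \<le> ereal (G \<bullet> X - nuclear_norm X)"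
        using \<epsilon> by (intro bexI[of _ "(k / \<epsilon>) *\<^sub>R ?D"])
          (simp_all add: nuclear_norm_scaleR field_simps, simp add: \<epsilon>_def algebra_simps)
    qed
    then show ?thesis using False by (simp add: conj indicator_fun_def)
  qed
qed

definition nuclear_face :: "real ^ 'n ^ 'm \<Rightarrow> (real ^ 'n ^ 'm) set" where
  "nuclear_face X = {G \<in> spec_ball. G \<bullet> X = nuclear_norm X}"

lemma subdiff_fenchel_conj_theta: "X \<in> subdiff (fenchel_conj theta) S \<longleftrightarrow> S \<in> nuclear_face X"
proof
  assume "X \<in> subdiff (fenchel_conj theta) S"
  then have S: "S \<in> spec_ball"
    and le: "\<And>G. G \<in> spec_ball \<Longrightarrow> X \<bullet> (G - S) \<le> 0"
    by (auto simp: subdiff_def fenchel_conj_theta indicator_fun_def zero_ereal_def split: if_splits)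
  obtain G where "G \<in> spec_ball" "G \<bullet> X = nuclear_norm X" by (rule nuclear_norm_attained)
  then have "nuclear_norm X \<le> S \<bullet> X" using le[of G] by (simp add: inner_diff_right inner_commute)
  then show "S \<in> nuclear_face X"
    using S spec_ball_inner_le_nuclear_norm[OF S, of X] by (auto simp: nuclear_face_def)
next
  assume "S \<in> nuclear_face X"
  then show "X \<in> subdiff (fenchel_conj theta) S"
    using spec_ball_inner_le_nuclear_norm[of _ X]
    by (auto simp: subdiff_def fenchel_conj_theta indicator_fun_def nuclear_face_def inner_diff_right inner_commute zero_ereal_def)
qed

text \<open>
  In \<open>\<langle>G, X\<rangle> = \<parallel>X\<parallel>\<^sub>*\<close> every summand \<open>\<langle>G v, X v\<rangle> \<le> \<parallel>X v\<parallel>\<close> has to be an equality, and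
  equality in the Cauchy-Schwarz inequality determines \<open>G v\<close>. Hence all members of the face agree on
  the row space of \<open>X\<close>, and so do their transposes on the column space.
\<close>
lemma nuclear_face_basis:
  assumes V: "singular_basis X V" and v: "v \<in> V" and G: "G \<in> nuclear_face X" and ne: "X *v v \<noteq> 0"
  shows "G *v v = (X *v v) /\<^sub>R norm (X *v v)" and "(X *v v) v* G = norm (X *v v) *\<^sub>R v"
proof -
  have B: "G \<in> spec_ball" and eq: "G \<bullet> X = nuclear_norm X" using G by (auto simp: nuclear_face_def)
  have nv: "norm v = 1" using V v by (auto simp: singular_basis_def)
  have le: "(G *v u) \<bullet> (X *v u) \<le> norm (X *v u)" if "u \<in> V" for u
    using spec_ball_bilinear[OF B, of "X *v u" u] V that by (simp add: inner_commute singular_basis_def)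
  have inner: "(G *v v) \<bullet> (X *v v) = norm (X *v v)"
  proof (rule ccontr)
    assume "(G *v v) \<bullet> (X *v v) \<noteq> norm (X *v v)"
    then have "(\<Sum>u\<in>V. (G *v u) \<bullet> (X *v u)) < (\<Sum>u\<in>V. norm (X *v u))"
      using le v singular_basis_finite[OF V] by (intro sum_strict_mono_ex1) (auto intro!: bexI[of _ v] simp: less_le)
    then show False
      using eq by (simp add: singular_basis_inner[OF V] nuclear_norm_singular_basis[OF V])
  qed
  let ?n = "norm (X *v v)"
  have n: "?n > 0" using ne by simp
  have "(norm (G *v v - (X *v v) /\<^sub>R ?n))\<^sup>2
      = (norm (G *v v))\<^sup>2 - 2 * ((G *v v) \<bullet> (X *v v)) / ?n + ((X *v v) \<bullet> (X *v v)) / ?n\<^sup>2"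
    by (simp only: power2_norm_eq_inner inner_diff inner_scaleR_left inner_scaleR_right)
      (simp add: inner_commute field_simps power2_eq_square dot_square_norm)
  also have "\<dots> = (norm (G *v v))\<^sup>2 - 1"
    using n by (simp add: inner dot_square_norm)
  also have "\<dots> \<le> 0" using B nv unfolding spec_ball_iff by (metis diff_le_0_iff_le norm_ge_zero power_le_one)
  finally show "G *v v = (X *v v) /\<^sub>R ?n" by simp
  have "(norm ((X *v v) v* G - ?n *\<^sub>R v))\<^sup>2 = (norm ((X *v v) v* G))\<^sup>2 - ?n\<^sup>2"
  proof -
    have "((X *v v) v* G) \<bullet> v = ?n" using inner by (metis dot_lmul_matrix inner_commute)
    then show ?thesis
      by (simp only: power2_norm_eq_inner inner_diff inner_scaleR_left inner_scaleR_right)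
        (simp add: inner_commute nv dot_square_norm power2_eq_square)
  qed
  also have "\<dots> \<le> 0" using spec_ball_vector_matrix[OF B, of "X *v v"] by (simp add: power_mono)
  finally show "(X *v v) v* G = ?n *\<^sub>R v" by simp
qed

section \<open>Epiderivatives of indicator functions\<close>

text \<open>
  Lower limits of indicator functions only say that certain points lie frequently in a set. This
  bound transfers inequalities that hold at such points to the limit.
\<close>
lemma frequently_tendsto_upperbound:
  fixes g :: "'a \<Rightarrow> real"
  assumes lim: "(g \<longlongrightarrow> L) F" and freq: "\<exists>\<^sub>F z in F. g z \<le> c"
  shows "L \<le> c"
proof (rule ccontr)
  assume "\<not> L \<le> c"
  then have "eventually (\<lambda>z. \<not> g z \<le> c) F" using order_tendstoD(1)[OF lim] by (simp add: not_le)
  then show False using freq by (simp add: frequently_def)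
qed

lemma eventually_positive_prod: "eventually (\<lambda>(t, d'). (0::real) < t) (at_right 0 \<times>\<^sub>F F)"
  using eventually_prodI[OF eventually_at_right_less[of 0] eventually_True] by (auto simp: case_prod_unfold)

lemma tendsto_prod_components:
  shows "(fst \<longlongrightarrow> (0::real)) (at_right 0 \<times>\<^sub>F nhds d)" "(snd \<longlongrightarrow> d) (at_right 0 \<times>\<^sub>F nhds d)"
  using filterlim_mono[OF filterlim_fst at_within_le_nhds order.refl] filterlim_snd by blast+

lemma frequently_along_curve:
  assumes lim: "(d' \<longlongrightarrow> d) (at_right (0::real))" and ev: "eventually (\<lambda>t. P (t, d' t)) (at_right 0)"
  shows "\<exists>\<^sub>F z in at_right 0 \<times>\<^sub>F nhds d. P z"
proof -
  have "filterlim (\<lambda>t. (t, d' t)) (at_right 0 \<times>\<^sub>F nhds d) (at_right 0)"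
    using lim by (intro filterlim_Pair filterlim_ident)
  moreover have "\<exists>\<^sub>F t in at_right 0. P (t, d' t)"
    using ev by (intro eventually_frequently) auto
  ultimately show ?thesis
    unfolding frequently_def filterlim_iff by blast
qed

lemma Liminf_zero_or_infinity:
  fixes f :: "'a \<Rightarrow> ereal"
  assumes F: "F \<noteq> bot" and ev: "eventually (\<lambda>z. f z = (if P z then 0 else \<infinity>)) F"
  shows "Liminf F f = (if \<exists>\<^sub>F z in F. P z then 0 else \<infinity>)"
proof (cases "\<exists>\<^sub>F z in F. P z")
  case True
  have "0 \<le> Liminf F f" using ev by (intro Liminf_bounded) (auto elim: eventually_mono)
  moreover have "\<not> 0 < Liminf F f"
  proof
    assume "0 < Liminf F f"
    then have "eventually (\<lambda>z. 0 < f z) F" by (rule less_LiminfD)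
    then have "eventually (\<lambda>z. \<not> P z) F" using ev by eventually_elim (auto split: if_splits)
    then show False using True by (simp add: frequently_def)
  qed
  ultimately show ?thesis using True by auto
next
  case False
  then have "eventually (\<lambda>z. \<not> P z) F" by (simp add: frequently_def)
  then have "eventually (\<lambda>z. f z = \<infinity>) F" using ev by eventually_elim auto
  then have "Liminf F f = Liminf F (\<lambda>z. \<infinity>)" by (rule Liminf_eq)
  then show ?thesis using False F by (simp add: Liminf_const)
qed

lemma epideriv_indicator:
  assumes "x \<in> D"
  shows "epideriv (indicator_fun D) x d =
    (if \<exists>\<^sub>F (t, d') in at_right 0 \<times>\<^sub>F nhds d. x + t *\<^sub>R d' \<in> D then 0 else \<infinity>)"
  unfolding epideriv_def
  by (rule Liminf_zero_or_infinity)
    (use assms in \<open>auto simp: indicator_fun_def prod_filter_eq_bot intro!: eventually_mono[OF eventually_positive_prod[of "nhds d"]]\<close>)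

text \<open>
  In a tangent direction, the second order epiderivative of an indicator function is the indicator
  function of the outer second order tangent set.
\<close>
lemma second_epideriv_indicator:
  assumes "x \<in> D" "epideriv (indicator_fun D) x d = 0"
  shows "second_epideriv (indicator_fun D) x d w =
    (if \<exists>\<^sub>F (t, w') in at_right 0 \<times>\<^sub>F nhds w. x + t *\<^sub>R d + (t\<^sup>2 / 2) *\<^sub>R w' \<in> D then 0 else \<infinity>)"
  unfolding second_epideriv_def
  by (rule Liminf_zero_or_infinity)
    (use assms in \<open>auto simp: indicator_fun_def prod_filter_eq_bot intro!: eventually_mono[OF eventually_positive_prod[of "nhds w"]]\<close>)

section \<open>Second order geometry of the spectral ball\<close>

text \<open>
  The tangent cone of the spectral ball at one of its points \<open>S\<close>, described by linear inequalities: only the vectors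
  whose norm is preserved by \<open>S\<close> restrict the direction.
\<close>
definition ball_tangent :: "real ^ 'n ^ 'm \<Rightarrow> real ^ 'n ^ 'm \<Rightarrow> bool" where
  "ball_tangent S H \<longleftrightarrow> (\<forall>v. norm (S *v v) = norm v \<longrightarrow> (S *v v) \<bullet> (H *v v) \<le> 0)"

text \<open>
  The spectral ball has no sharper curvature than a paraboloid. Split \<open>x = p + n\<close> with \<open>p\<close> in the
  subspace \<open>E\<close> on which \<open>S\<close> is isometric. On its complement \<open>S\<close> contracts by a factor
  \<open>\<rho> < 1\<close>, by compactness. The term of order \<open>t\<close> is nonpositive on \<open>E\<close>, and elsewhere it carries
  a factor \<open>\<parallel>n\<parallel>\<close>, so it is absorbed by the gain \<open>(1 - \<rho>\<^sup>2) \<parallel>n\<parallel>\<^sup>2\<close> up to an error of order \<open>t\<^sup>2\<close>.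
\<close>
lemma ball_tangent_growth:
  fixes S H :: "real ^ 'n ^ 'm"
  assumes S: "S \<in> spec_ball" and H: "ball_tangent S H"
  shows "\<exists>c\<ge>0. \<forall>t\<ge>0. \<forall>x. norm ((S + t *\<^sub>R H) *v x) \<le> (1 + c * t\<^sup>2) * norm x"
proof -
  define E where "E = {v. norm (S *v v) = norm v}"
  have E_eq: "v \<in> E \<longleftrightarrow> (S *v v) v* S = v" for v
  proof
    assume "v \<in> E"
    then have n: "norm (S *v v) = norm v" by (simp add: E_def)
    have "((S *v v) v* S) \<bullet> v = (norm (S *v v))\<^sup>2" "v \<bullet> ((S *v v) v* S) = (norm (S *v v))\<^sup>2"
      by (metis dot_lmul_matrix inner_commute power2_norm_eq_inner)+
    then have "(norm ((S *v v) v* S - v))\<^sup>2 = (norm ((S *v v) v* S))\<^sup>2 - 2 * (norm (S *v v))\<^sup>2 + (norm v)\<^sup>2"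
      by (simp only: power2_norm_eq_inner inner_diff)
    also have "\<dots> \<le> 0"
      using power_mono[OF spec_ball_vector_matrix[OF S, of "S *v v"], of 2] n by simp
    finally show "(S *v v) v* S = v" by simp
  next
    assume "(S *v v) v* S = v"
    then have "(S *v v) \<bullet> (S *v v) = v \<bullet> v" by (metis dot_lmul_matrix)
    then show "v \<in> E" by (simp add: E_def norm_eq)
  qed
  have sub: "subspace E"
    by (auto simp: subspace_def E_eq matrix_vector_right_distrib vector_matrix_left_distrib
        matrix_vector_mult_scaleR scaleR_vector_matrix_assoc)
  define N where "N = {z. \<forall>p\<in>E. orthogonal z p}"
  have subN: "subspace N" unfolding N_def by (auto simp: subspace_def orthogonal_def inner_add_left)
  obtain \<rho> where \<rho>: "\<rho> < 1" "\<rho> \<ge> 0" and bound: "\<And>z. z \<in> N \<Longrightarrow> norm (S *v z) \<le> \<rho> * norm z"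
  proof (cases "N \<inter> sphere 0 1 = {}")
    case True
    have "z = 0" if "z \<in> N" for z
    proof (rule ccontr)
      assume "z \<noteq> 0"
      then have "z /\<^sub>R norm z \<in> N \<inter> sphere 0 1" using that subN by (simp add: subspace_scale)
      then show False using True by blast
    qed
    then show ?thesis using that[of 0] by (metis less_numeral_extra(1) matrix_vector_mult_0_right mult_zero_left norm_zero order_refl)
  next
    case False
    have "compact (N \<inter> sphere 0 1)" using closed_subspace[OF subN] by (simp add: closed_Int_compact)
    moreover have "continuous_on (N \<inter> sphere 0 1) (\<lambda>z. norm (S *v z))"
      by (intro continuous_on_norm matrix_vector_mult_linear_continuous_on)
    ultimately obtain z0 where "z0 \<in> N \<inter> sphere 0 1"
      and "\<forall>z\<in>N \<inter> sphere 0 1. norm (S *v z) \<le> norm (S *v z0)"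
      using continuous_attains_sup[of "N \<inter> sphere 0 1" "\<lambda>z. norm (S *v z)"] False by blast
    then have z0: "z0 \<in> N" "norm z0 = 1"
      and max: "\<And>z. z \<in> N \<Longrightarrow> norm z = 1 \<Longrightarrow> norm (S *v z) \<le> norm (S *v z0)" by auto
    have "z0 \<notin> E" using z0 by (auto simp: N_def orthogonal_def)
    then have "norm (S *v z0) < 1" using S z0 unfolding spec_ball_iff E_def by (metis (mono_tags) less_le mem_Collect_eq)
    moreover have "norm (S *v z) \<le> norm (S *v z0) * norm z" if z: "z \<in> N" for z
    proof (cases "z = 0")
      case False
      then have "norm (S *v (z /\<^sub>R norm z)) \<le> norm (S *v z0)"
        using z subN by (intro max) (simp_all add: subspace_scale)
      then show ?thesis using False by (simp add: matrix_vector_mult_scaleR field_simps)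
    qed simp
    ultimately show ?thesis using that[of "norm (S *v z0)"] by simp
  qed
  define \<kappa> where "\<kappa> = 1 - \<rho>\<^sup>2"
  have \<kappa>: "\<kappa> > 0" using \<rho> by (simp add: \<kappa>_def abs_square_less_1)
  obtain K where K: "K > 0" "\<And>x. norm (H *v x) \<le> K * norm x"
    using bounded_linear.pos_bounded[of "(*v) H"] by (auto simp: mult.commute linear_conv_bounded_linear[symmetric])
  define c where "c = K\<^sup>2 * (1 + 9 / \<kappa>)"
  have c: "c \<ge> 0" using \<kappa> by (simp add: c_def)
  have "norm ((S + t *\<^sub>R H) *v x) \<le> (1 + c * t\<^sup>2) * norm x" if t: "t \<ge> 0" for t x
  proof -
    obtain p n where p: "p \<in> E" and "\<And>w. w \<in> E \<Longrightarrow> orthogonal n w" and x: "x = p + n"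
      using orthogonal_subspace_decomp_exists[of E x] unfolding span_eq_iff[THEN iffD2, OF sub]
      by metis
    then have n: "n \<in> N" by (simp add: N_def)
    have pn: "p \<bullet> n = 0" using p n by (auto simp: N_def orthogonal_def inner_commute)
    have nx: "(norm x)\<^sup>2 = (norm p)\<^sup>2 + (norm n)\<^sup>2"
      using pn by (simp add: x norm_add_Pythagorean orthogonal_def)
    have Spn: "(S *v p) \<bullet> (S *v n) = 0" using p pn by (metis E_eq dot_lmul_matrix)
    have le: "norm p \<le> norm x" "norm n \<le> norm x"
      by (rule power2_le_imp_le; simp add: nx)+
    have cross: "(S *v x) \<bullet> (H *v x) \<le> 3 * K * norm n * norm x"
    proof -
      have "(S *v p) \<bullet> (H *v p) \<le> 0" using H p by (simp add: ball_tangent_def E_def)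
      moreover have "(S *v a) \<bullet> (H *v d) \<le> norm a * (K * norm d)" for a d
      proof -
        have "(S *v a) \<bullet> (H *v d) \<le> norm (S *v a) * norm (H *v d)" by (rule norm_cauchy_schwarz)
        also have "\<dots> \<le> norm a * (K * norm d)" using S K(2) by (intro mult_mono) (auto simp: spec_ball_iff)
        finally show ?thesis .
      qed
      from this[of p n] this[of n x]
      have "(S *v p) \<bullet> (H *v n) \<le> norm p * (K * norm n)" "(S *v n) \<bullet> (H *v x) \<le> norm n * (K * norm x)" .
      moreover have "norm p * (K * norm n) \<le> norm x * (K * norm n)" using le K by (intro mult_right_mono) auto
      moreover have "(S *v x) \<bullet> (H *v x) = (S *v p) \<bullet> (H *v p) + (S *v p) \<bullet> (H *v n) + (S *v n) \<bullet> (H *v x)"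
        by (simp add: x matrix_vector_right_distrib inner_add)
      moreover have "0 \<le> norm n * (K * norm x)" using K by simp
      ultimately show ?thesis by (simp add: algebra_simps)
    qed
    have Sx: "(norm (S *v x))\<^sup>2 \<le> (norm x)\<^sup>2 - \<kappa> * (norm n)\<^sup>2"
    proof -
      have "(norm (S *v x))\<^sup>2 = (norm (S *v p))\<^sup>2 + (norm (S *v n))\<^sup>2"
        using Spn by (simp add: x matrix_vector_right_distrib norm_add_Pythagorean orthogonal_def)
      moreover have "norm (S *v p) = norm p" using p by (simp add: E_def)
      moreover have "(norm (S *v n))\<^sup>2 \<le> \<rho>\<^sup>2 * (norm n)\<^sup>2"
        using power_mono[OF bound[OF n], of 2] by (simp add: power_mult_distrib)
      ultimately show ?thesis by (simp add: nx \<kappa>_def algebra_simps)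
    qed
    have "(norm ((S + t *\<^sub>R H) *v x))\<^sup>2
        = (norm (S *v x))\<^sup>2 + 2 * t * ((S *v x) \<bullet> (H *v x)) + t\<^sup>2 * (norm (H *v x))\<^sup>2"
    proof -
      have "(S + t *\<^sub>R H) *v x = S *v x + t *\<^sub>R (H *v x)"
        by (simp add: matrix_vector_mult_add_rdistrib scaleR_matrix_vector_assoc)
      then show ?thesis
        by (simp only: power2_norm_eq_inner inner_add) (simp add: inner_commute power2_eq_square)
    qed
    also have "\<dots> \<le> ((norm x)\<^sup>2 - \<kappa> * (norm n)\<^sup>2) + 2 * t * (3 * K * norm n * norm x) + t\<^sup>2 * (K * norm x)\<^sup>2"
      using t cross Sx K(2)[of x] by (intro add_mono mult_left_mono power_mono) auto
    \<comment> \<open>The weight \<open>\<kappa>\<close> in this use of the inequality between the means cancels the gain exactly.\<close>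
    also have "2 * t * (3 * K * norm n * norm x) \<le> \<kappa> * (norm n)\<^sup>2 + 9 * t\<^sup>2 * K\<^sup>2 * (norm x)\<^sup>2 / \<kappa>"
    proof -
      have "0 \<le> (\<kappa> * norm n - 3 * t * K * norm x)\<^sup>2 / \<kappa>" using \<kappa> by simp
      also have "\<dots> = \<kappa> * (norm n)\<^sup>2 + 9 * t\<^sup>2 * K\<^sup>2 * (norm x)\<^sup>2 / \<kappa> - 2 * t * (3 * K * norm n * norm x)"
        using \<kappa> by (simp add: power2_eq_square field_simps)
      finally show ?thesis by simp
    qed
    finally have "(norm ((S + t *\<^sub>R H) *v x))\<^sup>2 \<le> (1 + c * t\<^sup>2) * (norm x)\<^sup>2"
      by (simp add: c_def power_mult_distrib algebra_simps)
    also have "\<dots> \<le> (1 + c * t\<^sup>2)\<^sup>2 * (norm x)\<^sup>2"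
      using c self_le_power[of "1 + c * t\<^sup>2" 2] by (intro mult_right_mono) auto
    finally show ?thesis
      unfolding power_mult_distrib[symmetric] by (rule power2_le_imp_le) (use c in simp)
  qed
  then show ?thesis using c by blast
qed

lemma frequently_ball_tangent:
  fixes S H :: "real ^ 'n ^ 'm"
  assumes freq: "\<exists>\<^sub>F (t, d') in at_right 0 \<times>\<^sub>F nhds H. S + t *\<^sub>R d' \<in> spec_ball"
  shows "ball_tangent S H"
  unfolding ball_tangent_def
proof (intro allI impI)
  fix v assume v: "norm (S *v v) = norm v"
  let ?F = "at_right (0::real) \<times>\<^sub>F nhds H"
  have "\<exists>\<^sub>F z in ?F. snd z \<bullet> outer (S *v v) v \<le> 0"
  proof -
    have "\<exists>\<^sub>F z in ?F. fst z > 0 \<and> S + fst z *\<^sub>R snd z \<in> spec_ball"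
      using frequently_eventually_conj[OF freq eventually_positive_prod[of "nhds H"]] 
      by (simp add: case_prod_unfold)
    then show ?thesis
    proof (rule frequently_elim1)
      fix z assume z: "fst z > 0 \<and> S + fst z *\<^sub>R snd z \<in> spec_ball"
      have "(S + fst z *\<^sub>R snd z) \<bullet> outer (S *v v) v \<le> norm (S *v v) * norm v"
        unfolding inner_outer using z spec_ball_bilinear by blast
      then have "fst z * (snd z \<bullet> outer (S *v v) v) \<le> 0"
        using v by (simp add: inner_add_left inner_outer[of S] dot_square_norm power2_eq_square)
      then show "snd z \<bullet> outer (S *v v) v \<le> 0" using z by (simp add: mult_le_0_iff)
    qed
  qed
  moreover have "((\<lambda>z. snd z \<bullet> outer (S *v v) v) \<longlongrightarrow> H \<bullet> outer (S *v v) v) ?F"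
    by (intro tendsto_intros tendsto_prod_components)
  ultimately have "H \<bullet> outer (S *v v) v \<le> 0" by (rule frequently_tendsto_upperbound[rotated])
  then show "(S *v v) \<bullet> (H *v v) \<le> 0" by (simp add: inner_outer)
qed

text \<open>
  If the parabola \<open>u + t p + t\<^sup>2/2 q\<close> does not leave the ball of radius \<open>\<parallel>u\<parallel>\<close> and starts in a tangent
  direction \<open>p\<close>, then its acceleration must compensate the curvature of the sphere: expand the
  squared norm, divide by \<open>t\<^sup>2\<close> and let \<open>t\<close> tend to zero.
\<close>
lemma parabolic_constraint:
  fixes L :: "'a::euclidean_space \<Rightarrow> 'b::euclidean_space"
  assumes L: "linear L" and orth: "u \<bullet> p = 0"
    and freq: "\<exists>\<^sub>F (t, w') in at_right 0 \<times>\<^sub>F nhds w. norm (u + t *\<^sub>R p + (t\<^sup>2 / 2) *\<^sub>R L w') \<le> norm u"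
  shows "u \<bullet> L w \<le> - (norm p)\<^sup>2"
proof -
  let ?F = "at_right (0::real) \<times>\<^sub>F nhds w"
  let ?g = "\<lambda>z. (norm p)\<^sup>2 + u \<bullet> L (snd z) + fst z * (p \<bullet> L (snd z)) + (fst z)\<^sup>2 / 4 * (norm (L (snd z)))\<^sup>2"
  have "\<exists>\<^sub>F z in ?F. fst z > 0 \<and> norm (u + fst z *\<^sub>R p + ((fst z)\<^sup>2 / 2) *\<^sub>R L (snd z)) \<le> norm u"
    using frequently_eventually_conj[OF freq eventually_positive_prod[of "nhds w"]] 
    by (simp add: case_prod_unfold)
  then have "\<exists>\<^sub>F z in ?F. ?g z \<le> 0"
  proof (rule frequently_elim1)
    fix z :: "real \<times> 'a"
    define t q where "t = fst z" and "q = L (snd z)"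
    assume "fst z > 0 \<and> norm (u + fst z *\<^sub>R p + ((fst z)\<^sup>2 / 2) *\<^sub>R L (snd z)) \<le> norm u"
    then have t: "t > 0" and "norm (u + t *\<^sub>R p + (t\<^sup>2 / 2) *\<^sub>R q) \<le> norm u" by (auto simp: t_def q_def)
    then have "(norm (u + t *\<^sub>R p + (t\<^sup>2 / 2) *\<^sub>R q))\<^sup>2 \<le> (norm u)\<^sup>2" by (intro power_mono) auto
    moreover have "(norm (u + t *\<^sub>R p + (t\<^sup>2 / 2) *\<^sub>R q))\<^sup>2
        = (norm u)\<^sup>2 + t\<^sup>2 * ((norm p)\<^sup>2 + u \<bullet> q + t * (p \<bullet> q) + t\<^sup>2 / 4 * (norm q)\<^sup>2)"
      unfolding power2_norm_eq_inner inner_add_left inner_add_right inner_scaleR_left inner_scaleR_right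
        orth inner_commute[of p u] inner_commute[of q u] inner_commute[of q p]
      by (simp add: power2_eq_square field_simps)
    ultimately have "t\<^sup>2 * ((norm p)\<^sup>2 + u \<bullet> q + t * (p \<bullet> q) + t\<^sup>2 / 4 * (norm q)\<^sup>2) \<le> 0" by simp
    then show "?g z \<le> 0" using t unfolding t_def q_def by (simp add: mult_le_0_iff)
  qed
  moreover have "(?g \<longlongrightarrow> (norm p)\<^sup>2 + u \<bullet> L w + 0 * (p \<bullet> L w) + 0\<^sup>2 / 4 * (norm (L w))\<^sup>2) ?F"
    using bounded_linear.tendsto[OF L[unfolded linear_conv_bounded_linear] tendsto_prod_components(2)]
    by (intro tendsto_intros tendsto_prod_components) auto
  ultimately have "(norm p)\<^sup>2 + u \<bullet> L w + 0 * (p \<bullet> L w) + 0\<^sup>2 / 4 * (norm (L w))\<^sup>2 \<le> 0"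
    by (rule frequently_tendsto_upperbound[rotated])
  then show ?thesis by simp
qed

text \<open>
  For a singular basis this says that \<open>H\<close> vanishes on the row space of \<open>X\<close>, and its transpose on the
  column space.
\<close>
definition annihilates_support :: "(real ^ 'n) set \<Rightarrow> real ^ 'n ^ 'm \<Rightarrow> real ^ 'n ^ 'm \<Rightarrow> bool" where
  "annihilates_support V X H \<longleftrightarrow>
     (\<forall>v\<in>V. X *v v \<noteq> 0 \<longrightarrow> H *v v = 0 \<and> (X *v v) v* H = 0)"

lemma annihilates_support_inner:
  assumes "singular_basis X V" "annihilates_support V X H"
  shows "H \<bullet> X = 0"
  unfolding singular_basis_inner[OF assms(1)] using assms(2)
  by (intro sum.neutral) (auto simp: annihilates_support_def)

text \<open>
  The numbers \<open>\<langle>H v, X v\<rangle>\<close> are nonpositive by tangency and add up to \<open>\<langle>H, X\<rangle> = 0\<close>.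
\<close>
lemma critical_direction_orthogonal:
  fixes X S H :: "real ^ 'n ^ 'm"
  assumes V: "singular_basis X V" and S: "S \<in> nuclear_face X"
    and H: "ball_tangent S H" "H \<bullet> X = 0" and v: "v \<in> V"
  shows "(X *v v) \<bullet> (H *v v) = 0"
proof -
  have le: "(H *v u) \<bullet> (X *v u) \<le> 0" if u: "u \<in> V" for u
  proof (cases "X *v u = 0")
    case False
    have Su: "S *v u = (X *v u) /\<^sub>R norm (X *v u)" by (rule nuclear_face_basis[OF V u S False])
    then have "norm (S *v u) = norm u" using False V u by (simp add: singular_basis_def)
    then have "(S *v u) \<bullet> (H *v u) \<le> 0" using H by (simp add: ball_tangent_def)
    then show ?thesis using False by (simp add: Su inner_commute mult_le_0_iff)
  qed simp
  have "(\<Sum>u\<in>V. - ((H *v u) \<bullet> (X *v u))) = 0"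
    using H(2) by (simp add: singular_basis_inner[OF V] sum_negf)
  then have "\<forall>u\<in>V. - ((H *v u) \<bullet> (X *v u)) = 0"
    using le singular_basis_finite[OF V] by (subst (asm) sum_nonneg_eq_0_iff) auto
  then show ?thesis using v by (simp add: inner_commute)
qed

text \<open>
  The parabolic constraint applied to the images of \<open>v\<close> under \<open>S + t H + t\<^sup>2/2 W\<close>, and to the images
  of \<open>X v\<close> under the transpose, which start on a sphere because \<open>S\<close> is in the face. The second bound
  is multiplied by \<open>\<parallel>X v\<parallel>\<close> to cover the case \<open>X v = 0\<close>.
\<close>
lemma second_order_tangent_bound:
  fixes X S H W :: "real ^ 'n ^ 'm"
  assumes V: "singular_basis X V" and S: "S \<in> nuclear_face X"
    and H: "ball_tangent S H" "H \<bullet> X = 0" and v: "v \<in> V"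
    and freq: "\<exists>\<^sub>F (t, w') in at_right 0 \<times>\<^sub>F nhds W. S + t *\<^sub>R H + (t\<^sup>2 / 2) *\<^sub>R w' \<in> spec_ball"
  shows "(W *v v) \<bullet> (X *v v) \<le> - norm (X *v v) * (norm (H *v v))\<^sup>2"
    and "(norm (X *v v)) * ((W *v v) \<bullet> (X *v v)) \<le> - (norm ((X *v v) v* H))\<^sup>2"
proof -
  let ?F = "at_right (0::real) \<times>\<^sub>F nhds W"
  let ?n = "norm (X *v v)"
  have "(W *v v) \<bullet> (X *v v) \<le> - ?n * (norm (H *v v))\<^sup>2
     \<and> ?n * ((W *v v) \<bullet> (X *v v)) \<le> - (norm ((X *v v) v* H))\<^sup>2"
  proof (cases "X *v v = 0")
    case False
    note Sv = nuclear_face_basis[OF V v S False]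
    have orth: "(X *v v) \<bullet> (H *v v) = 0" by (rule critical_direction_orthogonal[OF V S H v])
    have nv: "norm v = 1" using V v by (simp add: singular_basis_def)
    have "(S *v v) \<bullet> (W *v v) \<le> - (norm (H *v v))\<^sup>2"
    proof (rule parabolic_constraint[where L = "\<lambda>W. W *v v"])
      show "linear (\<lambda>W :: real ^ 'n ^ 'm. W *v v)"
        by (intro linearI) (simp_all add: matrix_vector_mult_add_rdistrib scaleR_matrix_vector_assoc)
      show "(S *v v) \<bullet> (H *v v) = 0" using orth by (simp add: Sv)
      show "\<exists>\<^sub>F (t, w') in ?F. norm (S *v v + t *\<^sub>R (H *v v) + (t\<^sup>2 / 2) *\<^sub>R (w' *v v)) \<le> norm (S *v v)"
        using freq
      proof (rule frequently_elim1, clarify)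
        fix t w' assume "S + t *\<^sub>R H + (t\<^sup>2 / 2) *\<^sub>R w' \<in> spec_ball"
        then have "norm ((S + t *\<^sub>R H + (t\<^sup>2 / 2) *\<^sub>R w') *v v) \<le> norm v" by (simp add: spec_ball_iff)
        moreover have "norm (S *v v) = norm v" using False nv by (simp add: Sv)
        ultimately show "norm (S *v v + t *\<^sub>R (H *v v) + (t\<^sup>2 / 2) *\<^sub>R (w' *v v)) \<le> norm (S *v v)"
          by (simp add: matrix_vector_mult_add_rdistrib scaleR_matrix_vector_assoc)
      qed
    qed
    then have 1: "(W *v v) \<bullet> (X *v v) \<le> - ?n * (norm (H *v v))\<^sup>2"
      using False by (simp add: Sv inner_commute field_simps)
    have "((X *v v) v* S) \<bullet> ((X *v v) v* W) \<le> - (norm ((X *v v) v* H))\<^sup>2"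
    proof (rule parabolic_constraint[where L = "\<lambda>W. (X *v v) v* W"])
      show "linear (\<lambda>W :: real ^ 'n ^ 'm. (X *v v) v* W)"
        by (intro linearI) (simp_all add: vector_matrix_mult_add_rdistrib vector_scaleR_matrix_ac)
      show "((X *v v) v* S) \<bullet> ((X *v v) v* H) = 0"
        using orth by (simp add: Sv inner_commute[of v] dot_lmul_matrix)
      show "\<exists>\<^sub>F (t, w') in ?F. norm ((X *v v) v* S + t *\<^sub>R ((X *v v) v* H) + (t\<^sup>2 / 2) *\<^sub>R ((X *v v) v* w'))
          \<le> norm ((X *v v) v* S)"
        using freq
      proof (rule frequently_elim1, clarify)
        fix t w' assume "S + t *\<^sub>R H + (t\<^sup>2 / 2) *\<^sub>R w' \<in> spec_ball"
        then have "norm ((X *v v) v* (S + t *\<^sub>R H + (t\<^sup>2 / 2) *\<^sub>R w')) \<le> ?n"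
          by (rule spec_ball_vector_matrix)
        moreover have "norm ((X *v v) v* S) = ?n" using nv by (simp add: Sv)
        ultimately show "norm ((X *v v) v* S + t *\<^sub>R ((X *v v) v* H) + (t\<^sup>2 / 2) *\<^sub>R ((X *v v) v* w'))
            \<le> norm ((X *v v) v* S)"
          by (simp add: vector_matrix_mult_add_rdistrib vector_scaleR_matrix_ac)
      qed
    qed
    then have "?n * ((W *v v) \<bullet> (X *v v)) \<le> - (norm ((X *v v) v* H))\<^sup>2"
      by (simp add: Sv inner_commute[of v] inner_commute[of "W *v v"] dot_lmul_matrix)
    with 1 show ?thesis by blast
  qed simp
  then show "(W *v v) \<bullet> (X *v v) \<le> - norm (X *v v) * (norm (H *v v))\<^sup>2"
    and "(norm (X *v v)) * ((W *v v) \<bullet> (X *v v)) \<le> - (norm ((X *v v) v* H))\<^sup>2" by blast+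
qed

text \<open>
  On the row space of \<open>X\<close> the matrices \<open>S + t H\<close> and \<open>P\<close> coincide, while \<open>P\<close> vanishes on the kernel
  of \<open>X\<close>. The convex combination therefore multiplies only the action on the kernel by \<open>k\<close>. As the
  images of the row space and of the kernel under \<open>S + t H\<close> are orthogonal, it suffices to control
  the norm on each of the two.
\<close>
lemma shrunk_perturbation_in_face:
  fixes X S H :: "real ^ 'n ^ 'm"
  assumes V: "singular_basis X V" and S: "S \<in> nuclear_face X" and H: "annihilates_support V X H"
    and k: "0 \<le> k" "\<And>x. k * norm ((S + t *\<^sub>R H) *v x) \<le> norm x"
  defines "P \<equiv> polar_factor X V"
  shows "P + k *\<^sub>R (S + t *\<^sub>R H - P) \<in> nuclear_face X"
proof -
  let ?T = "S + t *\<^sub>R H"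
  let ?G = "P + k *\<^sub>R (?T - P)"
  have Pf: "P \<in> nuclear_face X"
    using polar_factor_spec_ball[OF V] polar_factor_inner[OF V] by (simp add: P_def nuclear_face_def)
  have "?G \<bullet> X = nuclear_norm X"
    using Pf S annihilates_support_inner[OF V H] by (simp add: nuclear_face_def inner_add_left inner_diff_left)
  moreover have "?G \<in> spec_ball"
    unfolding spec_ball_iff
  proof
    fix x
    define x1 x2 where "x1 = (\<Sum>v\<in>{v\<in>V. X *v v \<noteq> 0}. (x \<bullet> v) *\<^sub>R v)"
      and "x2 = (\<Sum>v\<in>{v\<in>V. X *v v = 0}. (x \<bullet> v) *\<^sub>R v)"
    note fin = singular_basis_finite[OF V]
    have x: "x = x1 + x2"
    proof -
      have "x = (\<Sum>v\<in>V. (x \<bullet> v) *\<^sub>R v)"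
        using V by (intro orthonormal_expansion) (auto simp: singular_basis_def)
      also have "V = {v\<in>V. X *v v \<noteq> 0} \<union> {v\<in>V. X *v v = 0}" by auto
      also have "(\<Sum>v\<in>\<dots>. (x \<bullet> v) *\<^sub>R v) = x1 + x2"
        unfolding x1_def x2_def using fin by (intro sum.union_disjoint) auto
      finally show ?thesis .
    qed
    have mult_sum: "M *v (\<Sum>v\<in>A. (x \<bullet> v) *\<^sub>R v) = (\<Sum>v\<in>A. (x \<bullet> v) *\<^sub>R (M *v v))" for M :: "real ^ 'n ^ 'm" and A
      by (simp add: linear_sum[OF matrix_vector_mul_linear] matrix_vector_mult_scaleR)
    have orth: "x1 \<bullet> x2 = 0"
      unfolding x1_def x2_def inner_sum_left inner_sum_right using V
      by (intro sum.neutral ballI) (auto simp: singular_basis_def pairwise_def orthogonal_def)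
    have T1: "?T *v x1 = P *v x1"
    proof -
      have "?T *v v = P *v v" if "v \<in> V" "X *v v \<noteq> 0" for v
        using that nuclear_face_basis(1)[OF V that(1) S that(2)] nuclear_face_basis(1)[OF V that(1) Pf that(2)] H
        by (simp add: annihilates_support_def matrix_vector_mult_add_rdistrib scaleR_matrix_vector_assoc[symmetric])
      then show ?thesis unfolding x1_def mult_sum by (intro sum.cong) auto
    qed
    have P2: "P *v x2 = 0"
      unfolding x2_def mult_sum P_def by (intro sum.neutral) (auto simp: polar_factor_basis[OF V])
    have Gx: "?G *v x = P *v x1 + k *\<^sub>R (?T *v x2)"
    proof -
      have "?G *v x = P *v x + k *\<^sub>R (?T *v x - P *v x)"
        by (simp add: matrix_vector_mult_add_rdistrib matrix_vector_mult_diff_rdistrib scaleR_matrix_vector_assoc[symmetric])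
      also have "\<dots> = P *v x1 + k *\<^sub>R (?T *v x2)"
        using T1 P2 by (simp add: x matrix_vector_right_distrib)
      finally show ?thesis .
    qed
    have orth': "(P *v x1) \<bullet> (?T *v x2) = 0"
    proof -
      have "(P *v v) \<bullet> (?T *v u) = 0" if v: "v \<in> V" "X *v v \<noteq> 0" and u: "u \<in> V" "X *v u = 0" for v u
      proof -
        have "(X *v v) v* ?T = norm (X *v v) *\<^sub>R v"
          using nuclear_face_basis(2)[OF V v(1) S v(2)] v H
          by (simp add: annihilates_support_def vector_matrix_mult_add_rdistrib vector_scaleR_matrix_ac)
        moreover have "v \<bullet> u = 0" using V v u by (auto simp: singular_basis_def pairwise_def orthogonal_def)
        ultimately have "(X *v v) \<bullet> (?T *v u) = 0" by (simp flip: dot_lmul_matrix)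
        then show ?thesis by (simp add: P_def polar_factor_basis[OF V v(1)])
      qed
      then show ?thesis
        unfolding x1_def x2_def mult_sum inner_sum_left inner_sum_right by (intro sum.neutral ballI) auto
    qed
    have "(norm (?G *v x))\<^sup>2 = (norm (P *v x1))\<^sup>2 + (k * norm (?T *v x2))\<^sup>2"
      unfolding Gx using orth' k(1) by (simp add: norm_add_Pythagorean orthogonal_def)
    also have "\<dots> \<le> (norm x1)\<^sup>2 + (norm x2)\<^sup>2"
      using Pf k by (intro add_mono power_mono) (auto simp: nuclear_face_def spec_ball_iff)
    also have "\<dots> = (norm x)\<^sup>2" using orth by (simp add: x norm_add_Pythagorean orthogonal_def)
    finally show "norm (?G *v x) \<le> norm x" by (simp add: power2_le_iff_abs_le)
  qed
  ultimately show ?thesis by (simp add: nuclear_face_def)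
qed

text \<open>
  The factor \<open>k = 1 / (1 + c t\<^sup>2)\<close> compensates the growth of \<open>S + t H\<close>. The correction
  \<open>(k - 1) (S + t H - P)\<close> is of order \<open>t\<^sup>2\<close>, and divided by \<open>t\<^sup>2/2\<close> it tends to a multiple of
  \<open>S - P\<close>, which is orthogonal to \<open>X\<close> as both matrices lie in the face.
\<close>
lemma curve_in_face:
  fixes X S H :: "real ^ 'n ^ 'm"
  assumes V: "singular_basis X V" and S: "S \<in> nuclear_face X"
    and H: "ball_tangent S H" "annihilates_support V X H"
  obtains W where "\<And>t. 0 \<le> t \<Longrightarrow> S + t *\<^sub>R H + (t\<^sup>2 / 2) *\<^sub>R W t \<in> nuclear_face X"
    and "(W \<longlongrightarrow> W 0) (at_right 0)" and "W 0 \<bullet> X = 0"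
proof -
  define P where "P = polar_factor X V"
  have SB: "S \<in> spec_ball" using S by (simp add: nuclear_face_def)
  obtain c where c: "c \<ge> 0" "\<And>t x. 0 \<le> t \<Longrightarrow> norm ((S + t *\<^sub>R H) *v x) \<le> (1 + c * t\<^sup>2) * norm x"
    using ball_tangent_growth[OF SB H(1)] by blast
  define W where "W t = - (2 * c / (1 + c * t\<^sup>2)) *\<^sub>R (S + t *\<^sub>R H - P)" for t
  have pos: "1 + c * t\<^sup>2 > 0" for t using c(1) by (simp add: add_pos_nonneg)
  have "S + t *\<^sub>R H + (t\<^sup>2 / 2) *\<^sub>R W t \<in> nuclear_face X" if t: "0 \<le> t" for t
  proof -
    define k where "k = 1 / (1 + c * t\<^sup>2)"
    have k: "- (t\<^sup>2 / 2 * (2 * c / (1 + c * t\<^sup>2))) = k - 1"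
      using pos[of t] by (simp add: k_def field_simps)
    have "P + k *\<^sub>R (S + t *\<^sub>R H - P) \<in> nuclear_face X"
      unfolding P_def
    proof (rule shrunk_perturbation_in_face[OF V S H(2)])
      show "0 \<le> k" using pos[of t] by (simp add: k_def)
      show "k * norm ((S + t *\<^sub>R H) *v x) \<le> norm x" for x
        using c(2)[OF t, of x] pos[of t] by (simp add: k_def field_simps)
    qed
    moreover have "(t\<^sup>2 / 2) *\<^sub>R W t = (k - 1) *\<^sub>R (S + t *\<^sub>R H - P)"
      unfolding W_def scaleR_scaleR k[symmetric] by simp
    then have "S + t *\<^sub>R H + (t\<^sup>2 / 2) *\<^sub>R W t = P + k *\<^sub>R (S + t *\<^sub>R H - P)"
      by (simp add: algebra_simps)
    ultimately show ?thesis by simp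
  qed
  moreover have "(W \<longlongrightarrow> W 0) (at_right 0)"
  proof -
    have "isCont W 0" unfolding W_def using pos[of 0] by (intro continuous_intros) auto
    then show ?thesis unfolding isCont_def by (rule filterlim_mono) (auto simp: at_le)
  qed
  moreover have "W 0 \<bullet> X = 0"
    using S polar_factor_inner[OF V] by (simp add: W_def P_def inner_diff_left nuclear_face_def)
  ultimately show ?thesis by (rule that)
qed

section \<open>Critical cones of the nuclear norm and its conjugate\<close>

lemma prod_right_nhds_nontrivial: "at_right (0::real) \<times>\<^sub>F nhds d \<noteq> bot"
  by (simp add: prod_filter_eq_bot)

lemma face_inner_le_epideriv_theta:
  fixes X G D :: "real ^ 'n ^ 'm"
  assumes G: "G \<in> nuclear_face X"
  shows "ereal (D \<bullet> G) \<le> epideriv theta X D"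
proof -
  let ?F = "at_right (0::real) \<times>\<^sub>F nhds D"
  have "ereal (D \<bullet> G) = Liminf ?F (\<lambda>z. ereal (snd z \<bullet> G))"
    by (rule lim_imp_Liminf[OF prod_right_nhds_nontrivial, symmetric])
      (intro tendsto_intros tendsto_prod_components)
  also have "\<dots> \<le> epideriv theta X D"
    unfolding epideriv_def
  proof (rule Liminf_mono, rule eventually_mono[OF eventually_positive_prod[of "nhds D"]], clarify)
    fix t :: real and d' assume t: "0 < t"
    have "G \<bullet> (X + t *\<^sub>R d') \<le> nuclear_norm (X + t *\<^sub>R d')"
      using G by (intro spec_ball_inner_le_nuclear_norm) (simp add: nuclear_face_def)
    then have "d' \<bullet> G \<le> (nuclear_norm (X + t *\<^sub>R d') - nuclear_norm X) / t"
      using G t by (simp add: nuclear_face_def inner_add_right inner_commute field_simps)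
    then show "ereal (snd (t, d') \<bullet> G) \<le> (theta (X + t *\<^sub>R d') - theta X) / ereal t"
      using t by (simp add: theta_def)
  qed
  finally show ?thesis .
qed

text \<open>
  The nontrivial half of Danskin's theorem. If the difference quotients stayed above
  \<open>c > \<langle>D, S\<rangle>\<close>, then a limit point of maximisers \<open>G n\<close> for \<open>X + s n D\<close>, which is a maximiser for
  \<open>X\<close>, would violate the assumption on \<open>D\<close>.
\<close>
lemma epideriv_theta_le:
  fixes X S D :: "real ^ 'n ^ 'm"
  assumes S: "S \<in> nuclear_face X" and D: "\<And>G. G \<in> nuclear_face X \<Longrightarrow> D \<bullet> G \<le> D \<bullet> S"
  shows "epideriv theta X D \<le> ereal (D \<bullet> S)"
proof (rule ccontr)
  assume "\<not> ?thesis"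
  then have "ereal (D \<bullet> S) < epideriv theta X D" by simp
  from ereal_dense2[OF this] obtain c where c: "D \<bullet> S < c" "ereal c < epideriv theta X D" by auto
  define s where "s n = inverse (real (Suc n))" for n
  have s: "s \<longlonglongrightarrow> 0" "\<And>n. s n > 0"
    unfolding s_def by (rule LIMSEQ_inverse_real_of_nat) simp
  have "filterlim s (at_right 0) sequentially"
    using s(1) s(2)[THEN less_imp_neq, symmetric] s(2) by (simp add: filterlim_at)
  then have "filterlim (\<lambda>n. (s n, D)) (at_right 0 \<times>\<^sub>F nhds D) sequentially"
    by (intro filterlim_Pair) simp_all
  moreover have "eventually (\<lambda>(t, d'). ereal c < (theta (X + t *\<^sub>R d') - theta X) / ereal t) (at_right 0 \<times>\<^sub>F nhds D)"
    using less_LiminfD[OF c(2)[unfolded epideriv_def]] by (simp add: case_prod_unfold)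
  ultimately have ev: "eventually (\<lambda>n. ereal c < (theta (X + s n *\<^sub>R D) - theta X) / ereal (s n)) sequentially"
    unfolding filterlim_iff by fastforce
  have "\<forall>n. \<exists>G. G \<in> spec_ball \<and> G \<bullet> (X + s n *\<^sub>R D) = nuclear_norm (X + s n *\<^sub>R D)"
    using nuclear_norm_attained by metis
  then obtain G where G: "\<And>n. G n \<in> spec_ball" "\<And>n. G n \<bullet> (X + s n *\<^sub>R D) = nuclear_norm (X + s n *\<^sub>R D)"
    by metis
  obtain L r where L: "L \<in> spec_ball" and r: "strict_mono r" and lim: "(G \<circ> r) \<longlonglongrightarrow> L"
    using spec_ball_compact G(1) unfolding compact_def by metis
  have sr: "(\<lambda>n. s (r n)) \<longlonglongrightarrow> 0" using LIMSEQ_subseq_LIMSEQ[OF s(1) r] by (simp add: o_def)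
  have Gr: "(\<lambda>n. G (r n)) \<longlonglongrightarrow> L" using lim by (simp add: o_def)
  have SB: "S \<in> spec_ball" "S \<bullet> X = nuclear_norm X" using S by (auto simp: nuclear_face_def)
  have "nuclear_norm X \<le> L \<bullet> X"
  proof (rule LIMSEQ_le)
    show "(\<lambda>n. nuclear_norm X + s (r n) * (S \<bullet> D) - s (r n) * (G (r n) \<bullet> D)) \<longlonglongrightarrow> nuclear_norm X"
      using Gr sr by (auto intro!: tendsto_eq_intros)
    show "(\<lambda>n. G (r n) \<bullet> X) \<longlonglongrightarrow> L \<bullet> X" using Gr by (intro tendsto_intros)
    have "nuclear_norm X + s n * (S \<bullet> D) - s n * (G n \<bullet> D) \<le> G n \<bullet> X" for n
      using spec_ball_inner_le_nuclear_norm[OF SB(1), of "X + s n *\<^sub>R D"] G(2)[of n] SB(2)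
      by (simp add: inner_add_right)
    then show "\<exists>N. \<forall>n\<ge>N. nuclear_norm X + s (r n) * (S \<bullet> D) - s (r n) * (G (r n) \<bullet> D) \<le> G (r n) \<bullet> X"
      by blast
  qed
  then have "L \<in> nuclear_face X"
    using L spec_ball_inner_le_nuclear_norm[OF L, of X] by (simp add: nuclear_face_def)
  then have "D \<bullet> L \<le> D \<bullet> S" by (rule D)
  moreover have "c \<le> D \<bullet> L"
  proof (rule LIMSEQ_le_const)
    show "(\<lambda>n. D \<bullet> G (r n)) \<longlonglongrightarrow> D \<bullet> L" using Gr by (intro tendsto_intros)
    have "eventually (\<lambda>n. c \<le> D \<bullet> G n) sequentially"
      using ev
    proof eventually_elim
      case (elim n)
      then have "c * s n < nuclear_norm (X + s n *\<^sub>R D) - nuclear_norm X"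
        using s(2)[of n] by (simp add: theta_def field_simps)
      also have "\<dots> \<le> s n * (D \<bullet> G n)"
        using spec_ball_inner_le_nuclear_norm[OF G(1), of n X] G(2)[of n]
        by (simp add: inner_add_right inner_commute)
      finally show ?case using s(2)[of n] by (simp add: mult.commute)
    qed
    then have "eventually (\<lambda>n. c \<le> D \<bullet> G (r n)) sequentially"
      using eventually_subseq[OF r] by blast
    then show "\<exists>N. \<forall>n\<ge>N. c \<le> D \<bullet> G (r n)" by (simp add: eventually_sequentially)
  qed
  ultimately show False using c by simp
qed

text \<open>
  The critical cone of the nuclear norm is the normal cone of the exposed face at \<open>S\<close>.
\<close>
lemma fun_crit_cone_theta:
  fixes X S :: "real ^ 'n ^ 'm"
  assumes S: "S \<in> nuclear_face X"
  shows "fun_crit_cone theta X S = {D. \<forall>G\<in>nuclear_face X. D \<bullet> G \<le> D \<bullet> S}"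
proof (intro set_eqI iffI)
  fix D assume "D \<in> fun_crit_cone theta X S"
  then show "D \<in> {D. \<forall>G\<in>nuclear_face X. D \<bullet> G \<le> D \<bullet> S}"
    using face_inner_le_epideriv_theta[of _ X D] by (auto simp: fun_crit_cone_def)
next
  fix D assume "D \<in> {D. \<forall>G\<in>nuclear_face X. D \<bullet> G \<le> D \<bullet> S}"
  then show "D \<in> fun_crit_cone theta X S"
    using epideriv_theta_le[OF S, of D] face_inner_le_epideriv_theta[OF S, of D]
    by (auto simp: fun_crit_cone_def intro: antisym)
qed

text \<open>
  The matrices \<open>S v v\<^sup>T\<close>, for \<open>v\<close> with \<open>\<parallel>S v\<parallel> = \<parallel>v\<parallel>\<close>, and \<open>a v\<^sup>T\<close>, \<open>X v a\<^sup>T\<close>, for \<open>v\<close> in the basis with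
  \<open>X v \<noteq> 0\<close> and arbitrary \<open>a\<close>, are normal to the face, and a direction in the polar has to respect
  them. The choice \<open>a = H v\<close>, respectively \<open>a = H\<^sup>T X v\<close>, makes the resulting inequality a statement
  about a squared norm. Conversely, a direction with these properties is tangent to the face along
  the curve constructed above.
\<close>
lemma polar_fun_crit_cone_theta:
  fixes X S :: "real ^ 'n ^ 'm"
  assumes V: "singular_basis X V" and S: "S \<in> nuclear_face X"
  shows "H \<in> polar_cone (fun_crit_cone theta X S) \<longleftrightarrow> ball_tangent S H \<and> annihilates_support V X H"
proof
  assume "H \<in> polar_cone (fun_crit_cone theta X S)"
  then have polar: "H \<bullet> D \<le> 0" if "\<And>G. G \<in> nuclear_face X \<Longrightarrow> G \<bullet> D \<le> S \<bullet> D" for D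
    using that by (simp add: polar_cone_def fun_crit_cone_theta[OF S] inner_commute)
  have "ball_tangent S H"
    unfolding ball_tangent_def
  proof (intro allI impI)
    fix v assume v: "norm (S *v v) = norm v"
    have "H \<bullet> outer (S *v v) v \<le> 0"
    proof (rule polar)
      fix G assume "G \<in> nuclear_face X"
      then have "(S *v v) \<bullet> (G *v v) \<le> norm (S *v v) * norm v"
        by (intro spec_ball_bilinear) (simp add: nuclear_face_def)
      then show "G \<bullet> outer (S *v v) v \<le> S \<bullet> outer (S *v v) v"
        using v by (simp add: inner_outer dot_square_norm power2_eq_square)
    qed
    then show "(S *v v) \<bullet> (H *v v) \<le> 0" by (simp add: inner_outer)
  qed
  moreover have "annihilates_support V X H"
    unfolding annihilates_support_def
  proof (intro ballI impI)
    fix v assume v: "v \<in> V" and ne: "X *v v \<noteq> 0"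
    note face = nuclear_face_basis[OF V v _ ne]
    have "H \<bullet> outer (H *v v) v \<le> 0"
      by (rule polar) (simp add: inner_outer face(1) face(1)[OF S])
    moreover have "H \<bullet> outer (X *v v) ((X *v v) v* H) \<le> 0"
    proof (rule polar)
      fix G assume G: "G \<in> nuclear_face X"
      show "G \<bullet> outer (X *v v) ((X *v v) v* H) \<le> S \<bullet> outer (X *v v) ((X *v v) v* H)"
        unfolding inner_outer dot_lmul_matrix[symmetric] face(2)[OF G] face(2)[OF S] ..
    qed
    ultimately have "(H *v v) \<bullet> (H *v v) \<le> 0" "((X *v v) v* H) \<bullet> ((X *v v) v* H) \<le> 0"
      unfolding inner_outer by (simp_all add: dot_lmul_matrix)
    then show "H *v v = 0 \<and> (X *v v) v* H = 0" by (simp add: dot_square_norm)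
  qed
  ultimately show "ball_tangent S H \<and> annihilates_support V X H" ..
next
  assume H: "ball_tangent S H \<and> annihilates_support V X H"
  obtain W where W: "\<And>t. 0 \<le> t \<Longrightarrow> S + t *\<^sub>R H + (t\<^sup>2 / 2) *\<^sub>R W t \<in> nuclear_face X"
    "(W \<longlongrightarrow> W 0) (at_right 0)"
    using curve_in_face[OF V S] H by metis
  show "H \<in> polar_cone (fun_crit_cone theta X S)"
    unfolding polar_cone_def
  proof (intro CollectI ballI)
    fix D assume "D \<in> fun_crit_cone theta X S"
    then have D: "D \<bullet> G \<le> D \<bullet> S" if "G \<in> nuclear_face X" for G using that by (simp add: fun_crit_cone_theta[OF S])
    have "eventually (\<lambda>t. D \<bullet> (H + (t / 2) *\<^sub>R W t) \<le> 0) (at_right 0)"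
    proof (rule eventually_mono[OF eventually_at_right_less])
      fix t :: real assume t: "0 < t"
      have "D \<bullet> (S + t *\<^sub>R H + (t\<^sup>2 / 2) *\<^sub>R W t) \<le> D \<bullet> S" using W(1) t by (intro D) simp
      then have "t * (D \<bullet> (H + (t / 2) *\<^sub>R W t)) \<le> 0"
        by (simp add: inner_add_right power2_eq_square algebra_simps)
      then show "D \<bullet> (H + (t / 2) *\<^sub>R W t) \<le> 0" using t by (simp add: mult_le_0_iff)
    qed
    moreover have "((\<lambda>t. D \<bullet> (H + (t / 2) *\<^sub>R W t)) \<longlongrightarrow> D \<bullet> (H + (0 / 2) *\<^sub>R W 0)) (at_right 0)"
      by (intro tendsto_intros W(2)) simp
    ultimately have "D \<bullet> (H + (0 / 2) *\<^sub>R W 0) \<le> 0"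
      by (intro tendsto_upperbound) auto
    then show "D \<bullet> H \<le> 0" by simp
  qed
qed

lemma convex_cone_fun_crit_cone_theta:
  assumes "S \<in> nuclear_face X" shows "convex_cone (fun_crit_cone theta X S)"
  unfolding fun_crit_cone_theta[OF assms]
  by (auto simp: convex_cone_iff inner_add_left intro: add_mono mult_left_mono)

lemma fun_crit_cone_conj_theta:
  fixes X S :: "real ^ 'n ^ 'm"
  assumes S: "S \<in> nuclear_face X"
  shows "H \<in> fun_crit_cone (fenchel_conj theta) S X \<longleftrightarrow>
    (\<exists>\<^sub>F (t, d') in at_right 0 \<times>\<^sub>F nhds H. S + t *\<^sub>R d' \<in> spec_ball) \<and> H \<bullet> X = 0"
  using S unfolding fun_crit_cone_def nuclear_face_def fenchel_conj_theta
  by (auto simp: epideriv_indicator zero_ereal_def)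

text \<open>
  A direction tangent to the face is tangent to the ball and orthogonal to \<open>X\<close>.
\<close>
lemma polar_subset_fun_crit_cone_conj_theta:
  fixes X S :: "real ^ 'n ^ 'm"
  assumes S: "S \<in> nuclear_face X"
  shows "polar_cone (fun_crit_cone theta X S) \<subseteq> fun_crit_cone (fenchel_conj theta) S X"
proof
  fix H assume H: "H \<in> polar_cone (fun_crit_cone theta X S)"
  obtain V where V: "singular_basis X V" using singular_basis_exists by blast
  have H': "ball_tangent S H" "annihilates_support V X H"
    using H by (auto simp: polar_fun_crit_cone_theta[OF V S])
  obtain W where W: "\<And>t. 0 \<le> t \<Longrightarrow> S + t *\<^sub>R H + (t\<^sup>2 / 2) *\<^sub>R W t \<in> nuclear_face X"
    "(W \<longlongrightarrow> W 0) (at_right 0)"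
    using curve_in_face[OF V S H'] by metis
  have "((\<lambda>t. H + (t / 2) *\<^sub>R W t) \<longlongrightarrow> H + (0 / 2) *\<^sub>R W 0) (at_right 0)"
    by (intro tendsto_intros W(2)) simp
  moreover have "eventually (\<lambda>t. S + t *\<^sub>R (H + (t / 2) *\<^sub>R W t) \<in> spec_ball) (at_right 0)"
    using W(1) by (auto simp: eventually_at_filter nuclear_face_def algebra_simps power2_eq_square
      intro!: always_eventually)
  ultimately have "\<exists>\<^sub>F (t, d') in at_right 0 \<times>\<^sub>F nhds H. S + t *\<^sub>R d' \<in> spec_ball"
    using frequently_along_curve[of "\<lambda>t. H + (t / 2) *\<^sub>R W t" H "\<lambda>(t, d'). S + t *\<^sub>R d' \<in> spec_ball"] by simp
  then show "H \<in> fun_crit_cone (fenchel_conj theta) S X"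
    using annihilates_support_inner[OF V H'(2)] by (simp add: fun_crit_cone_conj_theta[OF S])
qed

text \<open>
  The conjugate is the supremum of \<open>\<langle>W, X\<rangle>\<close> over the second order tangent set \<open>T\<close>. If \<open>H\<close> does not
  vanish on the support of \<open>X\<close>, then one summand of \<open>\<langle>W, X\<rangle> = (\<Sum>v\<in>V. \<langle>W v, X v\<rangle>)\<close> is below a negative
  number that does not depend on \<open>W\<close>, while the others are nonpositive; otherwise the curve in the face yields an element of \<open>T\<close> orthogonal to
  \<open>X\<close>.
\<close>
lemma conj_second_epideriv_theta:
  fixes X S H :: "real ^ 'n ^ 'm"
  assumes S: "S \<in> nuclear_face X" and H: "H \<in> fun_crit_cone (fenchel_conj theta) S X"
  defines "\<psi> \<equiv> fenchel_conj (second_epideriv (fenchel_conj theta) S H) X"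
  shows "\<psi> \<le> 0" and "0 \<le> \<psi> \<longleftrightarrow> H \<in> polar_cone (fun_crit_cone theta X S)"
proof -
  obtain V where V: "singular_basis X V" using singular_basis_exists by blast
  have SB: "S \<in> spec_ball" using S by (simp add: nuclear_face_def)
  have freq: "\<exists>\<^sub>F (t, d') in at_right 0 \<times>\<^sub>F nhds H. S + t *\<^sub>R d' \<in> spec_ball" and HX: "H \<bullet> X = 0"
    using H by (auto simp: fun_crit_cone_conj_theta[OF S])
  have tang: "ball_tangent S H" by (rule frequently_ball_tangent[OF freq])
  define T where "T = {W. \<exists>\<^sub>F (t, w') in at_right 0 \<times>\<^sub>F nhds W. S + t *\<^sub>R H + (t\<^sup>2 / 2) *\<^sub>R w' \<in> spec_ball}"
  have "epideriv (indicator_fun spec_ball) S H = 0" using freq by (simp add: epideriv_indicator[OF SB])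
  then have phi: "second_epideriv (fenchel_conj theta) S H = indicator_fun T"
    unfolding fenchel_conj_theta
    by (auto simp: second_epideriv_indicator[OF SB] indicator_fun_def T_def fun_eq_iff)
  have le: "\<psi> \<le> ereal c" if "\<And>W. W \<in> T \<Longrightarrow> W \<bullet> X \<le> c" for c
    unfolding \<psi>_def phi fenchel_conj_def using that
    by (intro SUP_least) (auto simp: indicator_fun_def)
  note bound = second_order_tangent_bound[OF V S tang HX]
  have nonpos: "(W *v v) \<bullet> (X *v v) \<le> 0" if "W \<in> T" "v \<in> V" for W v
  proof -
    have "(W *v v) \<bullet> (X *v v) \<le> - norm (X *v v) * (norm (H *v v))\<^sup>2"
      using that by (intro bound(1)) (auto simp: T_def)
    also have "\<dots> \<le> 0" by simp
    finally show ?thesis .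
  qed
  have "W \<bullet> X \<le> 0" if "W \<in> T" for W
    unfolding singular_basis_inner[OF V] using nonpos[OF that] by (rule sum_nonpos)
  then show "\<psi> \<le> 0" using le[of 0] by (simp add: zero_ereal_def)
  show "0 \<le> \<psi> \<longleftrightarrow> H \<in> polar_cone (fun_crit_cone theta X S)"
  proof
    assume nonneg: "0 \<le> \<psi>"
    have "H *v v = 0 \<and> (X *v v) v* H = 0" if v: "v \<in> V" and ne: "X *v v \<noteq> 0" for v
    proof -
      have upper: "0 \<le> c" if c: "\<And>W. W \<in> T \<Longrightarrow> (W *v v) \<bullet> (X *v v) \<le> c" for c
      proof -
        have "\<psi> \<le> ereal c"
        proof (rule le)
          fix W assume W: "W \<in> T"
          have "W \<bullet> X = (W *v v) \<bullet> (X *v v) + (\<Sum>u\<in>V - {v}. (W *v u) \<bullet> (X *v u))"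
            unfolding singular_basis_inner[OF V] using v singular_basis_finite[OF V] by (rule sum.remove[rotated])
          also have "\<dots> \<le> c + 0" using c[OF W] nonpos[OF W] by (intro add_mono sum_nonpos) auto
          finally show "W \<bullet> X \<le> c" by simp
        qed
        then show ?thesis using nonneg order_trans by (metis ereal_less_eq(5))
      qed
      have "0 \<le> - norm (X *v v) * (norm (H *v v))\<^sup>2"
        by (rule upper) (use v bound(1) in \<open>auto simp: T_def\<close>)
      moreover have "0 \<le> - (norm ((X *v v) v* H))\<^sup>2 / norm (X *v v)"
      proof (rule upper)
        fix W assume "W \<in> T"
        then have "norm (X *v v) * ((W *v v) \<bullet> (X *v v)) \<le> - (norm ((X *v v) v* H))\<^sup>2"
          using v by (intro bound(2)) (auto simp: T_def)
        then show "(W *v v) \<bullet> (X *v v) \<le> - (norm ((X *v v) v* H))\<^sup>2 / norm (X *v v)"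
          using ne by (simp add: field_simps)
      qed
      ultimately show ?thesis using ne by (auto simp: mult_le_0_iff field_simps)
    qed
    then show "H \<in> polar_cone (fun_crit_cone theta X S)"
      using tang by (simp add: polar_fun_crit_cone_theta[OF V S] annihilates_support_def)
  next
    assume "H \<in> polar_cone (fun_crit_cone theta X S)"
    then have "ball_tangent S H" "annihilates_support V X H"
      by (auto simp: polar_fun_crit_cone_theta[OF V S])
    then obtain W where W: "\<And>t. 0 \<le> t \<Longrightarrow> S + t *\<^sub>R H + (t\<^sup>2 / 2) *\<^sub>R W t \<in> nuclear_face X"
      "(W \<longlongrightarrow> W 0) (at_right 0)" "W 0 \<bullet> X = 0"
      using curve_in_face[OF V S] by metis
    have "W 0 \<in> T"
      unfolding T_def
      using frequently_along_curve[OF W(2), of "\<lambda>(t, w'). S + t *\<^sub>R H + (t\<^sup>2 / 2) *\<^sub>R w' \<in> spec_ball"] W(1)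
      by (auto simp: eventually_at_filter nuclear_face_def intro!: always_eventually)
    then show "0 \<le> \<psi>"
      unfolding \<psi>_def phi fenchel_conj_def using W(3)
      by (intro SUP_upper2[of "W 0"]) (auto simp: indicator_fun_def zero_ereal_def)
  qed
qed

section \<open>Polyhedral cones and their polars\<close>

text \<open>
  This is what fails for general convex sets: among finitely many half-spaces, the inactive ones
  tolerate a common step size, and for the active ones the limit of the given directions does not
  leave the half-space.
\<close>
lemma polyhedron_feasible_direction:
  assumes Q: "polyhedron Q" and d: "d \<in> tangent_cone Q x"
  obtains \<epsilon> where "\<epsilon> > 0" "x + \<epsilon> *\<^sub>R d \<in> Q"
proof -
  obtain F where F: "finite F" "Q = \<Inter>F" "\<And>h. h \<in> F \<Longrightarrow> \<exists>a b. a \<noteq> 0 \<and> h = {z. a \<bullet> z \<le> b}"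
    using Q unfolding polyhedron_def by metis
  obtain t d' where x: "x \<in> Q" and t: "\<And>k. t k > 0" "\<And>k. x + t k *\<^sub>R d' k \<in> Q"
    and lim: "d' \<longlonglongrightarrow> d"
    using d unfolding tangent_cone_def by blast
  have "eventually (\<lambda>\<epsilon>. x + \<epsilon> *\<^sub>R d \<in> h) (at_right 0)" if h: "h \<in> F" for h
  proof -
    obtain a b where ab: "h = {z. a \<bullet> z \<le> b}" using F(3)[OF h] by blast
    have xh: "a \<bullet> x \<le> b" using x h ab F(2) by auto
    show ?thesis
    proof (cases "a \<bullet> x < b")
      case True
      have "((\<lambda>\<epsilon>. a \<bullet> (x + \<epsilon> *\<^sub>R d)) \<longlongrightarrow> a \<bullet> (x + 0 *\<^sub>R d)) (at_right 0)"
        by (intro tendsto_intros)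
      then have "eventually (\<lambda>\<epsilon>. a \<bullet> (x + \<epsilon> *\<^sub>R d) < b) (at_right 0)"
        using True by (intro order_tendstoD) auto
      then show ?thesis by eventually_elim (simp add: ab)
    next
      case False
      have "a \<bullet> d' k \<le> 0" for k
      proof -
        have "a \<bullet> (x + t k *\<^sub>R d' k) \<le> b" using t(2)[of k] h ab F(2) by auto
        then show ?thesis using False xh t(1)[of k] by (simp add: inner_add_right mult_le_0_iff)
      qed
      then have "a \<bullet> d \<le> 0"
        by (intro LIMSEQ_le_const2[OF tendsto_inner[OF tendsto_const lim]]) auto
      then have "a \<bullet> (x + \<epsilon> *\<^sub>R d) \<le> b" if "0 < \<epsilon>" for \<epsilon>
        using that xh mult_nonneg_nonpos[of \<epsilon> "a \<bullet> d"] by (simp add: inner_add_right)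
      then show ?thesis
        unfolding ab by (auto intro: eventually_mono[OF eventually_at_right_less[of 0]])
    qed
  qed
  then have "eventually (\<lambda>\<epsilon>. \<forall>h\<in>F. x + \<epsilon> *\<^sub>R d \<in> h) (at_right 0)"
    using F(1) by (simp add: eventually_ball_finite)
  then have "eventually (\<lambda>\<epsilon>. \<epsilon> > 0 \<and> x + \<epsilon> *\<^sub>R d \<in> Q) (at_right 0)"
    using eventually_at_right_less[of 0] by eventually_elim (simp add: F(2))
  then show ?thesis using that eventually_happens'[of "at_right (0::real)"] by force
qed

lemma feasible_direction_tangent:
  assumes Q: "convex Q" and x: "x \<in> Q" and \<epsilon>: "\<epsilon> > 0" "x + \<epsilon> *\<^sub>R d \<in> Q"
  shows "d \<in> tangent_cone Q x"
proof -
  have "x + (\<epsilon> / real (Suc k)) *\<^sub>R d \<in> Q" for k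
  proof -
    have "(1 - 1 / real (Suc k)) *\<^sub>R x + (1 / real (Suc k)) *\<^sub>R (x + \<epsilon> *\<^sub>R d) \<in> Q"
      using Q x \<epsilon>(2) by (intro convexD) auto
    then show ?thesis by (simp add: algebra_simps)
  qed
  moreover have "(\<lambda>k. \<epsilon> / real (Suc k)) \<longlonglongrightarrow> 0"
    by (rule LIMSEQ_Suc[OF lim_const_over_n])
  ultimately show ?thesis
    unfolding tangent_cone_def using x \<epsilon>(1)
    by (intro CollectI conjI exI[of _ "\<lambda>k. \<epsilon> / real (Suc k)"] exI[of _ "\<lambda>k. d"]) auto
qed

lemma tangent_cone_scaleR:
  assumes "d \<in> tangent_cone K x" "0 < c"
  shows "c *\<^sub>R d \<in> tangent_cone K x"
proof -
  obtain t d' where x: "x \<in> K" and t: "\<And>k. t k > 0" "\<And>k. x + t k *\<^sub>R d' k \<in> K"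
    and lim: "t \<longlonglongrightarrow> 0" "d' \<longlonglongrightarrow> d"
    using assms(1) unfolding tangent_cone_def by blast
  have "(\<lambda>k. t k / c) \<longlonglongrightarrow> 0" "(\<lambda>k. c *\<^sub>R d' k) \<longlonglongrightarrow> c *\<^sub>R d"
    using lim assms(2) by (auto intro!: tendsto_eq_intros)
  then show ?thesis
    unfolding tangent_cone_def using x t assms(2)
    by (intro CollectI conjI exI[of _ "\<lambda>k. t k / c"] exI[of _ "\<lambda>k. c *\<^sub>R d' k"]) auto
qed

lemma zero_in_tangent_cone:
  assumes "x \<in> K" shows "0 \<in> tangent_cone K x"
  unfolding tangent_cone_def using assms LIMSEQ_inverse_real_of_nat
  by (intro CollectI conjI exI[of _ "\<lambda>k. inverse (real (Suc k))"] exI[of _ "\<lambda>k. 0"]) auto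

lemma crit_cone_polyhedron_convex_cone:
  assumes Q: "polyhedron Q" and x: "x \<in> Q"
  shows "convex_cone (crit_cone Q x v)"
proof -
  have conv: "convex Q" by (rule polyhedron_imp_convex[OF Q])
  have add: "d + e \<in> tangent_cone Q x" if d: "d \<in> tangent_cone Q x" and e: "e \<in> tangent_cone Q x" for d e
  proof -
    obtain \<alpha> where \<alpha>: "\<alpha> > 0" "x + \<alpha> *\<^sub>R d \<in> Q" by (rule polyhedron_feasible_direction[OF Q d])
    obtain \<beta> where \<beta>: "\<beta> > 0" "x + \<beta> *\<^sub>R e \<in> Q" by (rule polyhedron_feasible_direction[OF Q e])
    have "(\<beta> / (\<alpha> + \<beta>)) *\<^sub>R (x + \<alpha> *\<^sub>R d) + (\<alpha> / (\<alpha> + \<beta>)) *\<^sub>R (x + \<beta> *\<^sub>R e) \<in> Q"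
      using \<alpha> \<beta> conv by (intro convexD) (auto simp: add_divide_distrib[symmetric] add.commute)
    also have "(\<beta> / (\<alpha> + \<beta>)) *\<^sub>R (x + \<alpha> *\<^sub>R d) + (\<alpha> / (\<alpha> + \<beta>)) *\<^sub>R (x + \<beta> *\<^sub>R e)
      = (\<beta> / (\<alpha> + \<beta>) + \<alpha> / (\<alpha> + \<beta>)) *\<^sub>R x + (\<alpha> * \<beta> / (\<alpha> + \<beta>)) *\<^sub>R (d + e)"
      by (simp add: algebra_simps)
    also have "\<beta> / (\<alpha> + \<beta>) + \<alpha> / (\<alpha> + \<beta>) = 1"
      using \<alpha> \<beta> by (simp add: add_divide_distrib[symmetric] add.commute)
    finally have "x + (\<alpha> * \<beta> / (\<alpha> + \<beta>)) *\<^sub>R (d + e) \<in> Q" by simp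
    then show ?thesis using \<alpha> \<beta> conv x by (intro feasible_direction_tangent) auto
  qed
  have "c *\<^sub>R d \<in> tangent_cone Q x" if "d \<in> tangent_cone Q x" "0 \<le> c" for c d
    using tangent_cone_scaleR[OF that(1), of c] that zero_in_tangent_cone[OF x] by (cases "c = 0") auto
  then show ?thesis
    using add zero_in_tangent_cone[OF x] by (auto simp: convex_cone_iff crit_cone_def inner_add_left)
qed

text \<open>
  The bipolar theorem for closed convex cones.
\<close>
lemma bipolar_point:
  assumes K: "convex_cone K" "closed K" and d: "\<And>z. z \<in> polar_cone K \<Longrightarrow> d \<bullet> z \<le> 0"
  shows "d \<in> K"
proof (rule ccontr)
  assume "d \<notin> K"
  then obtain a b where ab: "a \<bullet> d < b" "\<And>x. x \<in> K \<Longrightarrow> a \<bullet> x > b"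
    using separating_hyperplane_closed_point[of K d] K by (auto simp: convex_cone_def)
  have "0 \<in> K" using K(1) by (simp add: convex_cone_iff)
  then have b: "b < 0" using ab(2)[of 0] by simp
  have "0 \<le> a \<bullet> x" if x: "x \<in> K" for x
  proof (rule ccontr)
    assume neg: "\<not> 0 \<le> a \<bullet> x"
    have "(b / (a \<bullet> x)) *\<^sub>R x \<in> K" using K(1) x b neg by (intro convex_cone_scaleR) (auto simp: divide_nonpos_neg)
    then show False using ab(2)[of "(b / (a \<bullet> x)) *\<^sub>R x"] neg by simp
  qed
  then have "- a \<in> polar_cone K" by (simp add: polar_cone_def inner_commute)
  then have "d \<bullet> (- a) \<le> 0" by (rule d)
  then show False using ab(1) b by (simp add: inner_commute)
qed

lemma polar_cone_convex_cone: "convex_cone (polar_cone K)"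
  by (auto simp: convex_cone_iff polar_cone_def inner_add_right mult_nonneg_nonpos intro!: add_nonpos_nonpos)

text \<open>
  Since tangent directions of \<open>Q\<close> are feasible, the critical cone of \<open>Q\<close> is
  \<open>(Q \<inter> y\<^sup>\<bottom>) + \<real> q\<close>. Its polar is \<open>(Q \<inter> y\<^sup>\<bottom>)\<^sup>\<circ> \<inter> q\<^sup>\<bottom>\<close>, where \<open>(Q \<inter> y\<^sup>\<bottom>)\<^sup>\<circ>\<close> is the closure of
  \<open>K = Q\<^sup>\<circ> - \<real>\<^sub>+ y\<close>, and this closure is the tangent cone of \<open>Q\<^sup>\<circ>\<close> at \<open>y\<close>.
\<close>
lemma crit_cone_polar_polyhedron:
  assumes Q: "convex_cone Q" "polyhedron Q" and q: "q \<in> Q" and y: "y \<in> polar_cone Q" and qy: "q \<bullet> y = 0"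
  shows "crit_cone (polar_cone Q) y q = polar_cone (crit_cone Q q y)"
proof (intro set_eqI iffI)
  fix H assume "H \<in> crit_cone (polar_cone Q) y q"
  then obtain t d' where t: "\<And>k. t k > 0" "\<And>k. y + t k *\<^sub>R d' k \<in> polar_cone Q"
    and lim: "d' \<longlonglongrightarrow> H" and Hq: "H \<bullet> q = 0"
    unfolding crit_cone_def tangent_cone_def by blast
  show "H \<in> polar_cone (crit_cone Q q y)"
    unfolding polar_cone_def
  proof (intro CollectI ballI)
    fix d assume d: "d \<in> crit_cone Q q y"
    then obtain \<epsilon> where \<epsilon>: "\<epsilon> > 0" "q + \<epsilon> *\<^sub>R d \<in> Q"
      using polyhedron_feasible_direction[OF Q(2)] unfolding crit_cone_def by blast
    have "(q + \<epsilon> *\<^sub>R d) \<bullet> d' k \<le> 0" for k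
    proof -
      have "(q + \<epsilon> *\<^sub>R d) \<bullet> (y + t k *\<^sub>R d' k) \<le> 0" using t(2)[of k] \<epsilon>(2) by (simp add: polar_cone_def)
      then have "t k * ((q + \<epsilon> *\<^sub>R d) \<bullet> d' k) \<le> 0"
        using qy d by (simp add: crit_cone_def inner_add_left inner_add_right algebra_simps)
      then show ?thesis using t(1)[of k] by (simp add: mult_le_0_iff)
    qed
    then have "(q + \<epsilon> *\<^sub>R d) \<bullet> H \<le> 0"
      by (intro LIMSEQ_le_const2[OF tendsto_inner[OF tendsto_const lim]]) auto
    then show "d \<bullet> H \<le> 0" using Hq \<epsilon>(1) by (simp add: inner_add_left inner_commute[of q] mult_le_0_iff)
  qed
next
  fix H assume H: "H \<in> polar_cone (crit_cone Q q y)"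
  have conv: "convex Q" by (rule polyhedron_imp_convex[OF Q(2)])
  have crit: "d \<in> crit_cone Q q y" if "q + d \<in> Q" "d \<bullet> y = 0" for d
    using feasible_direction_tangent[OF conv q, of 1 d] that by (simp add: crit_cone_def)
  have "q \<in> crit_cone Q q y" using q qy Q(1) by (intro crit) (auto intro: convex_cone_add)
  moreover have "- q \<in> crit_cone Q q y" using Q(1) qy by (intro crit) (auto simp: convex_cone_iff)
  ultimately have "q \<bullet> H \<le> 0" "(- q) \<bullet> H \<le> 0" using H unfolding polar_cone_def by blast+
  then have Hq: "H \<bullet> q = 0" by (simp add: inner_commute)
  define K where "K = {z - s *\<^sub>R y | z s. z \<in> polar_cone Q \<and> 0 \<le> s}"
  have KI: "z - s *\<^sub>R y \<in> K" if "z \<in> polar_cone Q" "0 \<le> s" for z s using that by (auto simp: K_def)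
  have KE: "\<exists>z s. a = z - s *\<^sub>R y \<and> z \<in> polar_cone Q \<and> 0 \<le> s" if "a \<in> K" for a
    using that by (simp add: K_def)
  note P = polar_cone_convex_cone[of Q]
  have P0: "0 \<in> polar_cone Q" using P by (simp add: convex_cone_iff)
  have K0: "z \<in> K" if "z \<in> polar_cone Q" for z using KI[OF that, of 0] by simp
  have Kcone: "convex_cone K"
    unfolding convex_cone_iff
  proof (intro conjI ballI allI impI)
    show "0 \<in> K" by (rule K0[OF P0])
  next
    fix a a' assume "a \<in> K" "a' \<in> K"
    then obtain z s z' s' where *: "a = z - s *\<^sub>R y" "a' = z' - s' *\<^sub>R y"
        "z \<in> polar_cone Q" "z' \<in> polar_cone Q" "0 \<le> s" "0 \<le> s'"
      using KE by metis
    have "(z + z') - (s + s') *\<^sub>R y \<in> K" using * by (intro KI convex_cone_add[OF P]) auto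
    then show "a + a' \<in> K" unfolding *(1,2) by (simp add: algebra_simps)
  next
    fix a and c :: real assume "a \<in> K" "0 \<le> c"
    then obtain z s where *: "a = z - s *\<^sub>R y" "z \<in> polar_cone Q" "0 \<le> s" using KE by metis
    have "c *\<^sub>R z - (c * s) *\<^sub>R y \<in> K" using * \<open>0 \<le> c\<close> by (intro KI convex_cone_scaleR[OF P]) auto
    then show "c *\<^sub>R a \<in> K" unfolding *(1) by (simp add: algebra_simps)
  qed
  have "H \<in> closure K"
  proof (rule bipolar_point)
    show "convex_cone (closure K)"
      using Kcone by (simp add: convex_cone_def convex_closure conic_closure)
    fix d assume d: "d \<in> polar_cone (closure K)"
    then have d': "z \<bullet> d \<le> 0" if "z \<in> K" for z
      using that closure_subset[of K] by (auto simp: polar_cone_def)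
    have dQ: "d \<in> Q"
    proof (rule bipolar_point[OF Q(1) polyhedron_imp_closed[OF Q(2)]])
      show "d \<bullet> z \<le> 0" if "z \<in> polar_cone Q" for z using d'[OF K0[OF that]] by (simp add: inner_commute)
    qed
    have "d \<bullet> y \<le> 0" using y dQ by (simp add: polar_cone_def)
    moreover have "(0 - 1 *\<^sub>R y) \<bullet> d \<le> 0" by (intro d' KI P0) simp
    ultimately have "d \<bullet> y = 0" by (simp add: inner_commute)
    then have "d \<in> crit_cone Q q y" using q dQ Q(1) by (intro crit) (auto intro: convex_cone_add)
    then show "H \<bullet> d \<le> 0" using H by (simp add: polar_cone_def inner_commute[of H])
  qed simp
  then obtain k where k: "\<And>n. k n \<in> K" "k \<longlonglongrightarrow> H" unfolding closure_sequential by blast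
  have "\<forall>n. \<exists>z s. k n = z - s *\<^sub>R y \<and> z \<in> polar_cone Q \<and> 0 \<le> s" using KE[OF k(1)] by blast
  then obtain z s where zs: "\<And>n. k n = z n - s n *\<^sub>R y" "\<And>n. z n \<in> polar_cone Q" "\<And>n. 0 \<le> s n" by metis
  \<comment> \<open>The step sizes tend to zero and satisfy \<open>t n * s n \<le> 1\<close>, so that \<open>y + t n k n\<close> keeps a nonnegative multiple of \<open>y\<close>.\<close>
  define t where "t n = inverse (real (Suc n)) / (1 + s n)" for n
  have t: "t n > 0" "t n * s n \<le> 1" for n
  proof -
    show "t n > 0" using zs(3)[of n] by (simp add: t_def)
    have "t n * s n = inverse (real (Suc n)) * (s n / (1 + s n))" by (simp add: t_def)
    also have "\<dots> \<le> 1" using zs(3)[of n] by (intro mult_le_one) (auto simp: field_simps)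
    finally show "t n * s n \<le> 1" .
  qed
  have "t \<longlonglongrightarrow> 0"
  proof (rule tendsto_sandwich[OF _ _ tendsto_const LIMSEQ_inverse_real_of_nat])
    show "eventually (\<lambda>n. 0 \<le> t n) sequentially" using t(1) by (simp add: less_imp_le)
    show "eventually (\<lambda>n. t n \<le> inverse (real (Suc n))) sequentially"
    proof (intro always_eventually allI)
      fix n
      have "t n \<le> inverse (real (Suc n)) / 1"
        unfolding t_def using zs(3)[of n] by (intro divide_left_mono) auto
      then show "t n \<le> inverse (real (Suc n))" by simp
    qed
  qed
  moreover have "y + t n *\<^sub>R k n \<in> polar_cone Q" for n
  proof -
    have "(1 - t n * s n) *\<^sub>R y + t n *\<^sub>R z n \<in> polar_cone Q"
      using t[of n] y zs(2)[of n] convex_cone_add convex_cone_scaleR polar_cone_convex_cone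
      by (metis diff_ge_0_iff_ge less_imp_le)
    then show ?thesis by (simp add: zs(1) algebra_simps)
  qed
  ultimately have "H \<in> tangent_cone (polar_cone Q) y"
    unfolding tangent_cone_def using y t(1) k(2) by blast
  then show "H \<in> crit_cone (polar_cone Q) y q" using Hq by (simp add: crit_cone_def)
qed

lemma normal_cone_polar:
  assumes Q: "convex_cone Q" "closed Q" and q: "q \<in> normal_cone (polar_cone Q) y"
  shows "y \<in> polar_cone Q" "q \<in> Q" "q \<bullet> y = 0"
proof -
  note P = polar_cone_convex_cone[of Q]
  show y: "y \<in> polar_cone Q" using q by (simp add: normal_cone_def)
  have le: "q \<bullet> (z - y) \<le> 0" if "z \<in> polar_cone Q" for z using q that by (simp add: normal_cone_def)
  have "q \<bullet> (0 - y) \<le> 0" using P by (intro le) (simp add: convex_cone_iff)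
  moreover have "q \<bullet> ((y + y) - y) \<le> 0" using convex_cone_add[OF P y y] by (rule le)
  ultimately show qy: "q \<bullet> y = 0" by (simp add: inner_diff_right)
  show "q \<in> Q" using le by (intro bipolar_point Q) (simp add: inner_diff_right qy)
qed

section \<open>The constraint qualification as a statement about polars\<close>

text \<open>
  A pair \<open>(p, B)\<close> is in the sum iff \<open>p - A B \<in> K1 - A K2\<close>. A point outside of this convex cone can be
  separated from it, and the normal of the hyperplane is a nonzero element of the polar.
\<close>
lemma cone_qualification_iff_polar_trivial:
  fixes A :: "'a::euclidean_space \<Rightarrow> 'e::euclidean_space"
  assumes A: "linear A" and K1: "convex_cone K1" and K2: "convex_cone K2"
  shows "range (\<lambda>Z. (A Z, Z)) + K1 \<times> K2 = UNIV \<longleftrightarrow>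
    (\<forall>a. a \<in> polar_cone K1 \<longrightarrow> - adjoint A a \<in> polar_cone K2 \<longrightarrow> a = 0)"
proof
  assume sum: "range (\<lambda>Z. (A Z, Z)) + K1 \<times> K2 = UNIV"
  show "\<forall>a. a \<in> polar_cone K1 \<longrightarrow> - adjoint A a \<in> polar_cone K2 \<longrightarrow> a = 0"
  proof (intro allI impI)
    fix a assume a: "a \<in> polar_cone K1" "- adjoint A a \<in> polar_cone K2"
    have "(a, 0) \<in> range (\<lambda>Z. (A Z, Z)) + K1 \<times> K2" using sum by simp
    then obtain Z k1 k2 where Z: "a = A Z + k1" "Z + k2 = 0" "k1 \<in> K1" "k2 \<in> K2"
      by (auto simp: set_plus_def)
    have "a \<bullet> a = a \<bullet> A Z + k1 \<bullet> a" using Z(1) by (metis inner_add_right inner_commute)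
    also have "a \<bullet> A Z = k2 \<bullet> (- adjoint A a)"
      using Z(2) adjoint_works[OF A, of Z a] by (simp add: eq_neg_iff_add_eq_0[symmetric] inner_commute)
    also have "k2 \<bullet> (- adjoint A a) + k1 \<bullet> a \<le> 0"
      using a Z by (intro add_nonpos_nonpos) (auto simp: polar_cone_def)
    finally show "a = 0" by (simp add: dot_square_norm)
  qed
next
  assume triv: "\<forall>a. a \<in> polar_cone K1 \<longrightarrow> - adjoint A a \<in> polar_cone K2 \<longrightarrow> a = 0"
  let ?K = "K1 + (\<lambda>d. - A d) ` K2"
  have linA: "linear (\<lambda>d. - A d)" by (rule linear_compose_neg[OF A])
  have K: "convex_cone ?K"
  proof -
    have "?K = (\<Union>x\<in>K1. \<Union>z\<in>(\<lambda>d. - A d) ` K2. {x + z})" by (auto simp: set_plus_def)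
    then show ?thesis
      using convex_cone_sums[OF K1 convex_cone_linear_image[OF conjI[OF K2 linA]]] by simp
  qed
  have "?K = UNIV"
  proof (rule ccontr)
    assume "?K \<noteq> UNIV"
    then obtain r where r: "r \<notin> ?K" by blast
    then obtain n b where n: "n \<noteq> 0" "\<And>x. x \<in> ?K \<Longrightarrow> n \<bullet> x \<le> b"
      using separating_hyperplane_sets[of ?K "{r}"] K by (auto simp: convex_cone_def)
    have n0: "n \<bullet> x \<le> 0" if x: "x \<in> ?K" for x
    proof (rule ccontr)
      assume pos: "\<not> n \<bullet> x \<le> 0"
      have b: "0 \<le> b" using n(2)[of 0] K by (simp add: convex_cone_iff)
      have "((b + 1) / (n \<bullet> x)) *\<^sub>R x \<in> ?K" using pos b x by (intro convex_cone_scaleR[OF K]) auto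
      then show False using n(2)[of "((b + 1) / (n \<bullet> x)) *\<^sub>R x"] pos by simp
    qed
    have z: "0 \<in> K1" "0 \<in> K2" using K1 K2 by (auto simp: convex_cone_iff)
    have "n \<in> polar_cone K1"
      unfolding polar_cone_def
    proof (intro CollectI ballI)
      fix k assume "k \<in> K1"
      then have "k + - A 0 \<in> ?K" using z by (intro set_plus_intro) auto
      then show "k \<bullet> n \<le> 0" using n0[of k] linear_0[OF A] by (simp add: inner_commute)
    qed
    moreover have "- adjoint A n \<in> polar_cone K2"
      unfolding polar_cone_def
    proof (intro CollectI ballI)
      fix k assume "k \<in> K2"
      then have "0 + - A k \<in> ?K" using z by (intro set_plus_intro) auto
      then show "k \<bullet> (- adjoint A n) \<le> 0"
        using n0[of "- A k"] adjoint_works[OF A, of k n] by (simp add: inner_commute)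
    qed
    ultimately show False using triv n(1) by blast
  qed
  have "(p, B) \<in> range (\<lambda>Z. (A Z, Z)) + K1 \<times> K2" for p B
  proof -
    have "p - A B \<in> ?K" using \<open>?K = UNIV\<close> by simp
    then obtain k1 k2 where k: "k1 \<in> K1" "k2 \<in> K2" "p - A B = k1 + - A k2" by (auto elim!: set_plus_elim)
    have "(A (B - k2), B - k2) + (k1, k2) \<in> range (\<lambda>Z. (A Z, Z)) + K1 \<times> K2"
      using k(1,2) by (intro set_plus_intro) auto
    moreover have "p = A B - A k2 + k1" using k(3) by (simp add: algebra_simps)
    ultimately show ?thesis by (simp add: linear_diff[OF A])
  qed
  then show "range (\<lambda>Z. (A Z, Z)) + K1 \<times> K2 = UNIV" by auto
qed

section \<open>Curvature of the conjugate function\<close>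

lemma has_derivative_right_quotient:
  fixes F :: "'a::real_normed_vector \<Rightarrow> real"
  assumes "(F has_derivative F') (at v)"
  shows "((\<lambda>t. (F (v + t *\<^sub>R k) - F v) / t) \<longlongrightarrow> F' k) (at_right 0)"
proof -
  have lin: "linear F'" using assms by (rule has_derivative_linear)
  have "((\<lambda>t. v + t *\<^sub>R k) has_derivative (\<lambda>t. t *\<^sub>R k)) (at 0)"
    by (auto intro!: derivative_eq_intros)
  moreover have "(F has_derivative F') (at (v + 0 *\<^sub>R k))" using assms by simp
  ultimately have "((\<lambda>t. F (v + t *\<^sub>R k)) has_derivative (\<lambda>t. F' (t *\<^sub>R k))) (at 0)"
    by (rule has_derivative_compose)
  then have "((\<lambda>t. F (v + t *\<^sub>R k)) has_field_derivative F' k) (at 0)"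
    by (simp add: has_field_derivative_def linear_cmul[OF lin] mult_commute_abs)
  then have "((\<lambda>t. (F (v + t *\<^sub>R k) - F v) / t) \<longlongrightarrow> F' k) (at 0)"
    by (simp add: DERIV_def)
  then show ?thesis by (rule filterlim_mono) (simp_all add: at_le)
qed

lemma GDERIV_unique:
  assumes "GDERIV F x :> g" "GDERIV F x :> g'"
  shows "g = g'"
proof -
  have "(\<lambda>h. h \<bullet> g) = (\<lambda>h. h \<bullet> g')"
    using assms unfolding gderiv_def by (rule has_derivative_unique)
  then have "\<And>h. h \<bullet> (g - g') = 0" by (simp add: fun_eq_iff inner_diff_right)
  then show ?thesis by (metis inner_eq_zero_iff right_minus_eq)
qed

lemma GDERIV_grad:
  assumes "(\<lambda>z. real_of_ereal (f z)) differentiable (at x)"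
  shows "GDERIV (\<lambda>z. real_of_ereal (f z)) x :> grad f x"
proof -
  obtain F' where F': "((\<lambda>z. real_of_ereal (f z)) has_derivative F') (at x)"
    using assms by (auto simp: differentiable_def)
  have lin: "linear F'" using F' by (rule has_derivative_linear)
  have "F' = (\<lambda>k. k \<bullet> adjoint F' 1)" by (simp add: adjoint_works[OF lin])
  then have *: "GDERIV (\<lambda>z. real_of_ereal (f z)) x :> adjoint F' 1" using F' by (simp add: gderiv_def)
  show ?thesis unfolding grad_def by (rule theI, rule *) (rule GDERIV_unique[OF _ *])
qed

text \<open>
  Difference quotients of a convex function decrease with the step size, so the directional
  derivative bounds the increment from below.
\<close>
lemma gradient_in_subdiff:
  fixes f :: "'a::euclidean_space \<Rightarrow> ereal"
  assumes conv: "convex (ereal_epigraph f)" and proper: "\<And>z. f z \<noteq> -\<infinity>" and fin: "f v < \<infinity>"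
    and g: "GDERIV (\<lambda>z. real_of_ereal (f z)) v :> g"
  shows "g \<in> subdiff f v"
proof -
  have fv: "f v = ereal (real_of_ereal (f v))" using proper[of v] fin by (cases "f v") auto
  have "f v + ereal (g \<bullet> (z - v)) \<le> f z" for z
  proof (cases "f z = \<infinity>")
    case False
    then have fz: "f z = ereal (real_of_ereal (f z))" using proper[of z] by (cases "f z") auto
    let ?F = "\<lambda>z. real_of_ereal (f z)"
    have "eventually (\<lambda>t. (?F (v + t *\<^sub>R (z - v)) - ?F v) / t \<le> ?F z - ?F v) (at_right 0)"
      unfolding eventually_at_right_field
    proof (intro exI[of _ 1] conjI allI impI)
      fix t :: real assume t: "0 < t" "t < 1"
      have "(1 - t) *\<^sub>R (v, ?F v) + t *\<^sub>R (z, ?F z) \<in> ereal_epigraph f"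
        using t fv fz by (intro convexD[OF conv]) (simp_all add: ereal_epigraph_def)
      then have "f (v + t *\<^sub>R (z - v)) \<le> ereal ((1 - t) * ?F v + t * ?F z)"
        by (simp add: ereal_epigraph_def algebra_simps)
      then have "?F (v + t *\<^sub>R (z - v)) \<le> (1 - t) * ?F v + t * ?F z"
        using proper[of "v + t *\<^sub>R (z - v)"] by (cases "f (v + t *\<^sub>R (z - v))") auto
      then show "(?F (v + t *\<^sub>R (z - v)) - ?F v) / t \<le> ?F z - ?F v"
        using t by (simp add: field_simps)
    qed simp
    with has_derivative_right_quotient[OF g[unfolded gderiv_def], of "z - v"]
    have "(z - v) \<bullet> g \<le> ?F z - ?F v" by (intro tendsto_upperbound) auto
    then show ?thesis by (subst fv, subst fz) (simp add: inner_commute)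
  qed simp
  moreover have "\<bar>f v\<bar> \<noteq> \<infinity>" by (subst fv) simp
  ultimately show ?thesis by (simp add: subdiff_def)
qed

lemma subgradient_eq_gradient:
  fixes f :: "'a::euclidean_space \<Rightarrow> ereal"
  assumes w: "w \<in> subdiff f x" and x: "x \<in> interior (eff_dom f)"
    and g: "GDERIV (\<lambda>z. real_of_ereal (f z)) x :> g"
  shows "g = w"
proof -
  let ?F = "\<lambda>z. real_of_ereal (f z)"
  have fin: "\<bar>f x\<bar> \<noteq> \<infinity>" and sub: "\<And>z. f x + ereal (w \<bullet> (z - x)) \<le> f z" using w by (auto simp: subdiff_def)
  have le: "w \<bullet> k \<le> k \<bullet> g" for k
  proof -
    have "eventually (\<lambda>t. x + t *\<^sub>R k \<in> interior (eff_dom f)) (at_right 0)"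
    proof -
      have "((\<lambda>t. x + t *\<^sub>R k) \<longlongrightarrow> x + 0 *\<^sub>R k) (at_right 0)" by (intro tendsto_intros)
      then show ?thesis using x by (intro topological_tendstoD[of _ x]) auto
    qed
    then have "eventually (\<lambda>t. w \<bullet> k \<le> (?F (x + t *\<^sub>R k) - ?F x) / t) (at_right 0)"
      using eventually_at_right_less[of 0]
    proof eventually_elim
      case (elim t)
      then have "f (x + t *\<^sub>R k) < \<infinity>" using interior_subset by (auto simp: eff_dom_def)
      then have "?F x + t * (w \<bullet> k) \<le> ?F (x + t *\<^sub>R k)"
        using sub[of "x + t *\<^sub>R k"] fin by (cases "f x"; cases "f (x + t *\<^sub>R k)") auto
      then show ?case using elim by (simp add: field_simps)
    qed
    with has_derivative_right_quotient[OF g[unfolded gderiv_def], of k]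
    show ?thesis by (intro tendsto_lowerbound) auto
  qed
  have "(w - g) \<bullet> (w - g) \<le> 0" using le[of "w - g"] by (simp add: inner_diff_left inner_diff_right inner_commute)
  then show ?thesis by (simp add: dot_square_norm)
qed

lemma fenchel_conj_epigraph_convex: "convex (ereal_epigraph (fenchel_conj h))"
proof -
  have eq: "ereal_epigraph (fenchel_conj h) = (\<Inter>x. {(v, r). ereal (x \<bullet> v) - h x \<le> ereal r})"
    by (auto simp: ereal_epigraph_def fenchel_conj_def SUP_le_iff)
  have "convex {(v, r). ereal (x \<bullet> v) - h x \<le> ereal r}" for x
  proof (cases "h x")
    case (real a)
    have "convex {z :: 'a \<times> real. (x, -1) \<bullet> z \<le> a}" by (rule convex_halfspace_le)
    also have "{z :: 'a \<times> real. (x, -1) \<bullet> z \<le> a} = {(v, r). ereal (x \<bullet> v) - h x \<le> ereal r}"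
      by (auto simp: real)
    finally show ?thesis .
  qed auto
  then show ?thesis unfolding eq by (intro convex_INT)
qed

lemma fenchel_conj_not_MInf:
  assumes "proper_fun h" shows "fenchel_conj h v \<noteq> -\<infinity>"
proof -
  obtain x where x: "h x < \<infinity>" "h x \<noteq> -\<infinity>" using assms by (auto simp: proper_fun_def eff_dom_def)
  have "ereal (x \<bullet> v) - h x \<le> fenchel_conj h v" unfolding fenchel_conj_def by (rule SUP_upper) simp
  moreover have "ereal (x \<bullet> v) - h x \<noteq> -\<infinity>" using x by (cases "h x") auto
  ultimately show ?thesis by auto
qed

text \<open>
  The half of the Fenchel-Moreau theorem that inverts subdifferentials. It amounts to
  \<open>h x \<le> \<langle>x, v\<rangle> - h\<^sup>*(v)\<close>. Otherwise a hyperplane with normal \<open>(p, \<beta>)\<close> separates this point from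
  the epigraph. If \<open>\<beta> > 0\<close>, the subgradient inequality fails at \<open>- p / \<beta>\<close>; if the hyperplane is
  vertical, it fails at \<open>v - p\<close>.
\<close>
lemma subdiff_fenchel_conj:
  fixes h :: "'a::euclidean_space \<Rightarrow> ereal"
  assumes h: "proper_closed_convex h" and x: "x \<in> subdiff (fenchel_conj h) v"
  shows "v \<in> subdiff h x"
proof -
  have proper: "proper_fun h" and closed: "closed (ereal_epigraph h)" and conv: "convex (ereal_epigraph h)"
    using h by (auto simp: proper_closed_convex_def)
  have nMInf: "\<And>z. h z \<noteq> -\<infinity>" using proper by (simp add: proper_fun_def)
  obtain z0 a0 where z0: "h z0 = ereal a0"
  proof -
    obtain z where z: "h z < \<infinity>" using proper by (auto simp: proper_fun_def eff_dom_def)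
    then show ?thesis using nMInf[of z] that[of z] by (cases "h z") auto
  qed
  have fin: "\<bar>fenchel_conj h v\<bar> \<noteq> \<infinity>"
    and sub: "\<And>u. fenchel_conj h v + ereal (x \<bullet> (u - v)) \<le> fenchel_conj h u"
    using x by (auto simp: subdiff_def)
  obtain r where r: "fenchel_conj h v = ereal r" using fin by auto
  have conj_le: "fenchel_conj h u \<le> ereal c" if "\<And>z a. h z = ereal a \<Longrightarrow> z \<bullet> u - a \<le> c" for u c
    unfolding fenchel_conj_def
  proof (rule SUP_least)
    fix z show "ereal (z \<bullet> u) - h z \<le> ereal c" using that[of z] nMInf[of z] by (cases "h z") auto
  qed
  have young: "z \<bullet> v - a \<le> r" if "h z = ereal a" for z a
  proof -
    have "ereal (z \<bullet> v) - h z \<le> fenchel_conj h v" unfolding fenchel_conj_def by (rule SUP_upper) simp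
    then show ?thesis using that r by simp
  qed
  have key: "(x, x \<bullet> v - r) \<in> ereal_epigraph h"
  proof (rule ccontr)
    assume "(x, x \<bullet> v - r) \<notin> ereal_epigraph h"
    from separating_hyperplane_closed_point[OF conv closed this]
    obtain c b where cb: "c \<bullet> (x, x \<bullet> v - r) < b" "\<forall>e\<in>ereal_epigraph h. c \<bullet> e > b" by blast
    obtain p \<beta> where c: "c = (p, \<beta>)" by (cases c)
    have lt: "p \<bullet> x + \<beta> * (x \<bullet> v - r) < b" using cb(1) by (simp add: c)
    have gt: "p \<bullet> z + \<beta> * s > b" if "(z, s) \<in> ereal_epigraph h" for z s
      using bspec[OF cb(2) that] by (simp add: c)
    have epi: "p \<bullet> z + \<beta> * s > b" if "h z = ereal a" "a \<le> s" for z a s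
      using gt[of z s] that by (simp add: ereal_epigraph_def)
    have \<beta>: "\<beta> \<ge> 0"
    proof (rule ccontr)
      assume neg: "\<not> \<beta> \<ge> 0"
      define s where "s = max a0 ((b - p \<bullet> z0) / \<beta>)"
      have "p \<bullet> z0 + \<beta> * s > b" using z0 by (intro epi) (auto simp: s_def)
      moreover have "\<beta> * s \<le> \<beta> * ((b - p \<bullet> z0) / \<beta>)" using neg by (intro mult_left_mono_neg) (auto simp: s_def)
      ultimately show False using neg by simp
    qed
    show False
    proof (cases "\<beta> = 0")
      case False
      then have pos: "\<beta> > 0" using \<beta> by simp
      have "fenchel_conj h (- (1 / \<beta>) *\<^sub>R p) \<le> ereal (- b / \<beta>)"
      proof (rule conj_le)
        fix z a assume "h z = ereal a"
        then have "p \<bullet> z + \<beta> * a > b" by (intro epi) auto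
        then have "b / \<beta> \<le> (p \<bullet> z + \<beta> * a) / \<beta>" using pos by (intro divide_right_mono) auto
        then show "z \<bullet> (- (1 / \<beta>) *\<^sub>R p) - a \<le> - b / \<beta>"
          using pos by (simp add: inner_commute add_divide_distrib)
      qed
      with sub[of "- (1 / \<beta>) *\<^sub>R p"]
      have "ereal r + ereal (x \<bullet> (- (1 / \<beta>) *\<^sub>R p - v)) \<le> ereal (- b / \<beta>)" unfolding r by (rule order_trans)
      then have "r + x \<bullet> (- (1 / \<beta>) *\<^sub>R p - v) \<le> - b / \<beta>" by simp
      then have "\<beta> * (r + x \<bullet> (- (1 / \<beta>) *\<^sub>R p - v)) \<le> \<beta> * (- b / \<beta>)"
        using pos by (intro mult_left_mono) auto
      then have "b \<le> p \<bullet> x + \<beta> * (x \<bullet> v - r)"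
        using pos by (simp add: inner_diff_right inner_commute ring_distribs)
      then show False using lt by simp
    next
      case True
      have "fenchel_conj h (v - p) \<le> ereal (r - b)"
      proof (rule conj_le)
        fix z a assume z: "h z = ereal a"
        then have "p \<bullet> z + \<beta> * a > b" by (intro epi) auto
        then show "z \<bullet> (v - p) - a \<le> r - b" using young[OF z] True by (simp add: inner_diff_right inner_commute)
      qed
      with sub[of "v - p"] have "ereal r + ereal (x \<bullet> (v - p - v)) \<le> ereal (r - b)" unfolding r by (rule order_trans)
      then show False using lt True by (simp add: inner_commute)
    qed
  qed
  then have hx: "h x \<le> ereal (x \<bullet> v - r)" by (simp add: ereal_epigraph_def)
  then obtain a where a: "h x = ereal a" using nMInf[of x] by (cases "h x") auto
  have "h x + ereal (v \<bullet> (z - x)) \<le> h z" for z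
  proof (cases "h z")
    case (real c)
    then show ?thesis using young[OF real] hx a by (simp add: inner_diff_right inner_commute)
  qed (use nMInf in auto)
  then show ?thesis using a by (simp add: subdiff_def)
qed

text \<open>
  For a symmetric positive semidefinite operator, \<open>\<langle>D d, d\<rangle> = 0\<close> implies \<open>D d = 0\<close>. In place of the
  symmetry of \<open>D\<close>, the proof uses the cyclic monotonicity of subgradients along the triangle \<open>x0\<close>,
  \<open>x0 + t (d - s p)\<close>, \<open>x0 + t d\<close> with \<open>p = D d\<close>: dividing by \<open>t\<^sup>2\<close> and letting \<open>t\<close> tend to zero
  yields \<open>s \<langle>p, p\<rangle> - s\<^sup>2 \<langle>D p, p\<rangle> \<le> \<langle>p, d\<rangle>\<close>, whose left side is positive for small \<open>s > 0\<close>.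
\<close>
lemma curvature_positive:
  fixes h :: "'a::euclidean_space \<Rightarrow> ereal"
  assumes dom: "open (eff_dom h)" and sub: "\<And>x. x \<in> eff_dom h \<Longrightarrow> g x \<in> subdiff h x"
    and x0: "x0 \<in> eff_dom h" and D: "(g has_derivative D) (at x0)" and ne: "D d \<noteq> 0"
  shows "D d \<bullet> d > 0"
proof -
  have lin: "linear D" using D by (rule has_derivative_linear)
  have le: "real_of_ereal (h x) + g x \<bullet> (z - x) \<le> real_of_ereal (h z)" if "x \<in> eff_dom h" "z \<in> eff_dom h" for x z
    using sub[OF that(1)] that(2) unfolding subdiff_def eff_dom_def
    by (cases "h x"; cases "h z") (auto dest!: spec[of _ z])
  define p where "p = D d"
  have key: "s * (p \<bullet> p) - s\<^sup>2 * (D p \<bullet> p) \<le> p \<bullet> d" for s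
  proof -
    define e where "e = d - s *\<^sub>R p"
    have ev: "eventually (\<lambda>t. x0 + t *\<^sub>R k \<in> eff_dom h) (at_right 0)" for k
    proof -
      have "((\<lambda>t. x0 + t *\<^sub>R k) \<longlongrightarrow> x0 + 0 *\<^sub>R k) (at_right 0)" by (intro tendsto_intros)
      then show ?thesis using x0 dom by (intro topological_tendstoD[of _ x0]) auto
    qed
    have lim: "((\<lambda>t. (g (x0 + t *\<^sub>R k) \<bullet> c - g x0 \<bullet> c) / t) \<longlongrightarrow> D k \<bullet> c) (at_right 0)" for k c
      by (rule has_derivative_right_quotient) (intro has_derivative_inner_left D)
    have "eventually (\<lambda>t. (g (x0 + t *\<^sub>R e) \<bullet> (s *\<^sub>R p) - g x0 \<bullet> (s *\<^sub>R p)) / t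
        \<le> (g (x0 + t *\<^sub>R d) \<bullet> d - g x0 \<bullet> d) / t) (at_right 0)"
      using ev[of d] ev[of e] eventually_at_right_less[of 0]
    proof eventually_elim
      case (elim t)
      let ?a = "x0 + t *\<^sub>R d" and ?b = "x0 + t *\<^sub>R e"
      have "g x0 \<bullet> (?b - x0) + g ?b \<bullet> (?a - ?b) + g ?a \<bullet> (x0 - ?a) \<le> 0"
        using le[OF x0 elim(2)] le[OF elim(2) elim(1)] le[OF elim(1) x0] by linarith
      moreover have "?a - ?b = t *\<^sub>R (s *\<^sub>R p)" by (simp add: e_def algebra_simps)
      moreover have "?b - x0 = t *\<^sub>R (d - s *\<^sub>R p)" "x0 - ?a = - (t *\<^sub>R d)" by (simp_all add: e_def)
      ultimately have "t * (g x0 \<bullet> (d - s *\<^sub>R p) + g ?b \<bullet> (s *\<^sub>R p) - g ?a \<bullet> d) \<le> 0"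
        by (simp only: inner_scaleR_right inner_minus_right) (simp add: algebra_simps)
      then have "g x0 \<bullet> (d - s *\<^sub>R p) + g ?b \<bullet> (s *\<^sub>R p) - g ?a \<bullet> d \<le> 0"
        using elim(3) by (simp add: mult_le_0_iff)
      then show ?case using elim(3) by (intro divide_right_mono) (simp_all add: inner_diff_right)
    qed
    then have "D e \<bullet> (s *\<^sub>R p) \<le> D d \<bullet> d"
      by (intro tendsto_le[OF _ lim lim]) auto
    then show ?thesis
      by (simp add: e_def linear_diff[OF lin] linear_cmul[OF lin] p_def[symmetric] inner_diff_left power2_eq_square algebra_simps)
  qed
  \<comment> \<open>Now the quadratic term is at most half of the linear one; adding one avoids a zero denominator.\<close>
  define s where "s = (p \<bullet> p) / (2 * (\<bar>D p \<bullet> p\<bar> + 1))"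
  have pp: "p \<bullet> p > 0" using ne by (simp add: p_def)
  have s: "s > 0" using pp by (simp add: s_def add_nonneg_pos)
  have "s * (D p \<bullet> p) \<le> s * (\<bar>D p \<bullet> p\<bar> + 1)" using s by (intro mult_left_mono) auto
  also have "\<dots> = (p \<bullet> p) / 2" using abs_ge_zero[of "D p \<bullet> p"] by (simp add: s_def field_simps)
  also have "\<dots> < p \<bullet> p" using pp by simp
  finally have "0 < s * (p \<bullet> p - s * (D p \<bullet> p))" using s by simp
  also have "\<dots> = s * (p \<bullet> p) - s\<^sup>2 * (D p \<bullet> p)" by (simp add: power2_eq_square algebra_simps)
  also have "\<dots> \<le> p \<bullet> d" by (rule key)
  finally show ?thesis by (simp add: p_def)
qed

text \<open>
  This brings one-sided directional derivatives within the scope of the chain rule.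
\<close>
lemma right_quotient_iff_has_derivative:
  fixes x :: "real \<Rightarrow> 'a::real_normed_vector"
  shows "((\<lambda>t. (x t - x 0) /\<^sub>R t) \<longlongrightarrow> d) (at_right 0) \<longleftrightarrow>
    (x has_derivative (\<lambda>t. t *\<^sub>R d)) (at 0 within {0..})"
proof -
  have "((\<lambda>t. (1 / norm (t - 0)) *\<^sub>R (x t - (x 0 + (t - 0) *\<^sub>R d))) \<longlongrightarrow> 0) (at_right 0) \<longleftrightarrow>
      ((\<lambda>t. (x t - x 0) /\<^sub>R t - d) \<longlongrightarrow> 0) (at_right 0)"
    by (intro tendsto_cong eventually_mono[OF eventually_at_right_less[of 0]])
      (simp add: algebra_simps divide_inverse)
  moreover have "bounded_linear (\<lambda>t. t *\<^sub>R d)" by (rule bounded_linear_scaleR_left)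
  ultimately show ?thesis
    by (simp add: has_derivative_within at_within_Ici_at_right LIM_zero_iff)
qed

lemma derivative_along_tangent_curve:
  fixes g :: "'a::euclidean_space \<Rightarrow> 'b::euclidean_space"
  assumes D: "(g has_derivative D) (at (x 0))"
    and x: "((\<lambda>t. (x t - x 0) /\<^sub>R t) \<longlongrightarrow> d) (at_right (0::real))"
  shows "((\<lambda>t. (g (x t) - g (x 0)) /\<^sub>R t) \<longlongrightarrow> D d) (at_right 0)"
proof -
  have "((\<lambda>t. g (x t)) has_derivative (\<lambda>t. D (t *\<^sub>R d))) (at 0 within {0..})"
    using x D unfolding right_quotient_iff_has_derivative by (rule has_derivative_compose)
  then show ?thesis
    unfolding right_quotient_iff_has_derivative[of "\<lambda>t. g (x t)"]
    by (simp add: linear_cmul[OF has_derivative_linear[OF D]])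
qed

text \<open>
  Along \<open>w + t k\<close> the gradient of \<open>h\<^sup>*\<close> traces a curve with one-sided velocity \<open>d\<close> that the gradient
  of \<open>h\<close> maps back to \<open>w + t k\<close>. The chain rule gives \<open>D d = k\<close> for the Hessian \<open>D\<close> of \<open>h\<close>, so that
  \<open>\<langle>k, d\<rangle> = \<langle>D d, d\<rangle>\<close> is positive for \<open>k \<noteq> 0\<close>.
\<close>
lemma conjugate_curvature_positive:
  fixes h :: "'a::euclidean_space \<Rightarrow> ereal"
  assumes h: "proper_closed_convex h" and dom: "open (eff_dom h)" and C2: "twice_cont_diff_on h (eff_dom h)"
    and diff: "ereal_differentiable_on (fenchel_conj h) (interior (eff_dom (fenchel_conj h)))"
    and dir: "dir_differentiable_on (grad (fenchel_conj h)) (interior (eff_dom (fenchel_conj h)))"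
    and w: "w \<in> interior (eff_dom (fenchel_conj h))" and k: "k \<noteq> 0"
  shows "k \<bullet> dir_deriv (grad (fenchel_conj h)) w k > 0"
proof -
  let ?f = "fenchel_conj h" and ?U = "interior (eff_dom (fenchel_conj h))"
  have proper: "proper_fun h" and conv: "convex (ereal_epigraph h)"
    using h by (auto simp: proper_closed_convex_def)
  obtain g :: "'a \<Rightarrow> 'a" and D :: "'a \<Rightarrow> 'a \<Rightarrow>\<^sub>L 'a"
    where g: "\<And>x. x \<in> eff_dom h \<Longrightarrow> GDERIV (\<lambda>z. real_of_ereal (h z)) x :> g x"
      and D: "\<And>x. x \<in> eff_dom h \<Longrightarrow> (g has_derivative D x) (at x)"
    using C2 unfolding twice_cont_diff_on_def by blast
  have gsub: "g x \<in> subdiff h x" if "x \<in> eff_dom h" for x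
    using that proper by (intro gradient_in_subdiff conv g) (auto simp: proper_fun_def eff_dom_def)
  have inv: "grad ?f v \<in> eff_dom h \<and> g (grad ?f v) = v" if v: "v \<in> ?U" for v
  proof -
    have "v \<in> eff_dom ?f" using v interior_subset by blast
    then have "grad ?f v \<in> subdiff ?f v"
      using diff v fenchel_conj_not_MInf[OF proper] unfolding ereal_differentiable_on_def
      by (intro gradient_in_subdiff fenchel_conj_epigraph_convex GDERIV_grad) (auto simp: eff_dom_def)
    then have sub: "v \<in> subdiff h (grad ?f v)" by (rule subdiff_fenchel_conj[OF h])
    then have dom': "grad ?f v \<in> eff_dom h" by (auto simp: subdiff_def eff_dom_def)
    moreover have "g (grad ?f v) = v"
      using dom' dom by (intro subgradient_eq_gradient[OF sub] g) (simp_all add: interior_open)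
    ultimately show ?thesis ..
  qed
  define x where "x t = grad ?f (w + t *\<^sub>R k)" for t
  define d where "d = dir_deriv (grad ?f) w k"
  obtain l where "((\<lambda>t. (grad ?f (w + t *\<^sub>R k) - grad ?f w) /\<^sub>R t) \<longlongrightarrow> l) (at_right 0)"
    using dir w unfolding dir_differentiable_on_def by blast
  moreover from this have "d = l" unfolding d_def dir_deriv_def by (intro tendsto_Lim) auto
  ultimately have lim: "((\<lambda>t. (x t - x 0) /\<^sub>R t) \<longlongrightarrow> d) (at_right 0)" by (simp add: x_def)
  have x0: "x 0 \<in> eff_dom h" using inv[OF w] by (simp add: x_def)
  have "((\<lambda>t. (g (x t) - g (x 0)) /\<^sub>R t) \<longlongrightarrow> D (x 0) d) (at_right 0)"
    by (rule derivative_along_tangent_curve[OF D[OF x0] lim])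
  moreover have "((\<lambda>t. (g (x t) - g (x 0)) /\<^sub>R t) \<longlongrightarrow> k) (at_right 0)"
  proof -
    have "((\<lambda>t. w + t *\<^sub>R k) \<longlongrightarrow> w + 0 *\<^sub>R k) (at_right 0)" by (intro tendsto_intros)
    then have "eventually (\<lambda>t. w + t *\<^sub>R k \<in> ?U) (at_right 0)"
      using w by (intro topological_tendstoD[of _ w]) auto
    then have "eventually (\<lambda>t. (g (x t) - g (x 0)) /\<^sub>R t = k) (at_right 0)"
      using eventually_at_right_less[of 0]
    proof eventually_elim
      case (elim t)
      then show ?case using inv[OF elim(1)] inv[OF w] by (simp add: x_def)
    qed
    then show ?thesis by (rule tendsto_eventually)
  qed
  ultimately have Dd: "D (x 0) d = k" by (intro tendsto_unique[of "at_right 0"]) auto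
  show ?thesis
    using curvature_positive[OF dom gsub x0 D[OF x0], of d] k unfolding Dd by (simp add: d_def)
qed

section \<open>Duality of the two conditions\<close>

theorem theorem5p2:
  fixes h :: "real ^ 'd \<Rightarrow> ereal"
    and \<F> :: "real ^ 'n ^ 'm \<Rightarrow> real ^ 'd"
    and \<A> :: "real ^ 'n ^ 'm \<Rightarrow> real ^ 'e"
    and C :: "real ^ 'n ^ 'm"
    and b :: "real ^ 'e"
    and Q :: "(real ^ 'e) set"
    and y :: "real ^ 'e" and w :: "real ^ 'd" and S X :: "real ^ 'n ^ 'm"
  assumes h_convex: "proper_closed_convex h"
    and h_dom: "open (eff_dom h)" "convex (eff_dom h)" "eff_dom h \<noteq> {}"
    and h_C2: "twice_cont_diff_on h (eff_dom h)"
    and h_strict: "essentially_strictly_convex h"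
    and conj_diff: "ereal_differentiable_on (fenchel_conj h) (interior (eff_dom (fenchel_conj h)))"
    and conj_lip: "locally_lipschitz_on (grad (fenchel_conj h))
                     (interior (eff_dom (fenchel_conj h)))"
    and conj_dir: "dir_differentiable_on (grad (fenchel_conj h))
                     (interior (eff_dom (fenchel_conj h)))"
    and conj_subdiff: "\<And>v. v \<notin> interior (eff_dom (fenchel_conj h)) \<Longrightarrow>
                         subdiff (fenchel_conj h) v = {}"
    and lin: "linear \<F>" "linear \<A>"
    and Q_cone: "convex_cone Q" "polyhedron Q"
    and primal_solvable: "primal_solutions h \<F> \<A> C b Q \<noteq> {}"
    and dual_opt: "(y, w, S) \<in> dual_solutions h \<F> \<A> C b Q"
    and mult_nonempty: "dual_multipliers h \<F> \<A> C b Q y w S \<noteq> {}"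
    and mult: "X \<in> dual_multipliers h \<F> \<A> C b Q y w S"
  shows "dual_SOSC h \<F> \<A> b Q X y w S \<longleftrightarrow> primal_SRCQ \<A> b Q X y S"
proof -
  let ?q = "\<A> X - b"
  let ?CQ = "crit_cone Q ?q y" and ?CX = "fun_crit_cone theta X S"
  let ?curv = "\<lambda>Hw. Hw \<bullet> dir_deriv (grad (fenchel_conj h)) w Hw"
  let ?\<psi> = "\<lambda>HS. fenchel_conj (second_epideriv (fenchel_conj theta) S HS) X"
  have q: "?q \<in> normal_cone (polar_cone Q) y" and Xw: "\<F> X \<in> subdiff (fenchel_conj h) w"
    and S: "S \<in> nuclear_face X"
    using mult by (auto simp: dual_multipliers_def subdiff_fenchel_conj_theta)
  note qy = normal_cone_polar[OF Q_cone(1) polyhedron_imp_closed[OF Q_cone(2)] q]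
  have w: "w \<in> interior (eff_dom (fenchel_conj h))" using Xw conj_subdiff by blast
  have CQ: "crit_cone (polar_cone Q) y ?q = polar_cone ?CQ"
    by (rule crit_cone_polar_polyhedron[OF Q_cone qy(2,1,3)])
  have srcq: "primal_SRCQ \<A> b Q X y S \<longleftrightarrow>
      (\<forall>a. a \<in> polar_cone ?CQ \<longrightarrow> - adjoint \<A> a \<in> polar_cone ?CX \<longrightarrow> a = 0)"
    unfolding primal_SRCQ_def
    by (intro cone_qualification_iff_polar_trivial lin crit_cone_polyhedron_convex_cone Q_cone qy
        convex_cone_fun_crit_cone_theta S)
  have curv: "0 < ?curv Hw" if "Hw \<noteq> 0" for Hw
    by (rule conjugate_curvature_positive[OF h_convex h_dom(1) h_C2 conj_diff conj_dir w that])
  have form_pos: "0 < ereal (?curv Hw) - ?\<psi> HS \<longleftrightarrow> Hw \<noteq> 0 \<or> HS \<notin> polar_cone ?CX"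
    if HS: "HS \<in> fun_crit_cone (fenchel_conj theta) S X" for Hw HS
  proof -
    have "?\<psi> HS \<le> 0" and iff: "0 \<le> ?\<psi> HS \<longleftrightarrow> HS \<in> polar_cone ?CX"
      using conj_second_epideriv_theta[OF S HS] by blast+
    moreover have "0 \<le> ?curv Hw" using curv[of Hw] by (cases "Hw = 0") auto
    ultimately show ?thesis
      using curv[of Hw] unfolding iff[symmetric] by (cases "?\<psi> HS"; cases "Hw = 0") auto
  qed
  have "\<not> dual_SOSC h \<F> \<A> b Q X y w S \<longleftrightarrow>
      (\<exists>Hy. Hy \<noteq> 0 \<and> Hy \<in> polar_cone ?CQ \<and> - adjoint \<A> Hy \<in> polar_cone ?CX)"
  proof
    assume "\<not> dual_SOSC h \<F> \<A> b Q X y w S"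
    then obtain Hy Hw HS where crit: "(Hy, Hw, HS) \<in> dual_critical_cone \<F> \<A> b Q X y S"
      and ne: "(Hy, Hw, HS) \<noteq> 0" and nonpos: "\<not> 0 < ereal (?curv Hw) - ?\<psi> HS"
      unfolding dual_SOSC_def by auto
    have eq: "adjoint \<A> Hy + adjoint \<F> Hw + HS = 0" and Hy: "Hy \<in> polar_cone ?CQ"
      and HS: "HS \<in> fun_crit_cone (fenchel_conj theta) S X"
      using crit by (auto simp: dual_critical_cone_def CQ)
    have "Hw = 0" "HS \<in> polar_cone ?CX" using nonpos form_pos[OF HS] by auto
    moreover have "HS = - adjoint \<A> Hy"
      using eq \<open>Hw = 0\<close> linear_0[OF adjoint_linear[OF lin(1)]] by (simp add: eq_neg_iff_add_eq_0 add.commute)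
    moreover have "Hy \<noteq> 0"
      using ne calculation linear_0[OF adjoint_linear[OF lin(2)]] by (auto simp: zero_prod_def)
    ultimately show "\<exists>Hy. Hy \<noteq> 0 \<and> Hy \<in> polar_cone ?CQ \<and> - adjoint \<A> Hy \<in> polar_cone ?CX"
      using Hy by blast
  next
    assume "\<exists>Hy. Hy \<noteq> 0 \<and> Hy \<in> polar_cone ?CQ \<and> - adjoint \<A> Hy \<in> polar_cone ?CX"
    then obtain Hy where Hy: "Hy \<noteq> 0" "Hy \<in> polar_cone ?CQ" "- adjoint \<A> Hy \<in> polar_cone ?CX" by blast
    have HS: "- adjoint \<A> Hy \<in> fun_crit_cone (fenchel_conj theta) S X"
      using polar_subset_fun_crit_cone_conj_theta[OF S] Hy(3) by blast
    have "(Hy, 0, - adjoint \<A> Hy) \<in> dual_critical_cone \<F> \<A> b Q X y S - {0}"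
      using Hy HS linear_0[OF adjoint_linear[OF lin(1)]] by (simp add: dual_critical_cone_def CQ zero_prod_def)
    moreover have "\<not> 0 < ereal (?curv 0) - ?\<psi> (- adjoint \<A> Hy)" using form_pos[OF HS, of 0] Hy(3) by simp
    ultimately show "\<not> dual_SOSC h \<F> \<A> b Q X y w S" unfolding dual_SOSC_def by blast
  qed
  then show ?thesis unfolding srcq by blast
qed

end
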